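(* (a) For all $z\in\mathfrak H$ and all integers $m\geq 1$, $$E^{\varGamma_0(1)}(z,m+1)=(\operatorname{Im} z)^{m+1}+\frac{\sqrt{\pi}\,\Gamma(m+\frac12)}{\Gamma(m+1)}\frac{\zeta(2m+1)}{\zeta(2m+2)}\frac{1}{(\operatorname{Im} z)^{m}}-\frac{\pi(\operatorname{Im} z)^{m}}{(-2)^{m-1}\Gamma(m+1)\zeta(2m+2)}\left(\frac{\partial}{\partial \operatorname{Im} z}\frac{1}{\operatorname{Im} z}\right)^{m}\operatorname{Re}\sum_{n=1}^\infty\frac{1}{n^{2m+1}}\frac{1}{e^{2n\pi z/i}-1}.$$ (b) For all $z\in\mathfrak H$ and all integers $m\geq 1$, $$E^{\varGamma_0(4)}\left(-\frac{1}{4z},m+1\right)=\frac{2^{2m+1}-1}{2^{2m+2}-1}\frac{\sqrt{\pi}\,\Gamma(m+\frac12)}{2\Gamma(m+1)}\frac{\zeta(2m+1)}{\zeta(2m+2)}\frac{1}{(4\operatorname{Im} z)^m}$$ $$\qquad+\frac{\pi(\operatorname{Im} z)^{m}}{(-2)^{m-1}(2^{2m+2}-1)\Gamma(m+1)\zeta(2m+2)}\left(\frac{\partial}{\partial \operatorname{Im} z}\frac{1}{\operatorname{Im} z}\right)^{m}\operatorname{Re}\sum_{n=0}^\infty\frac{1}{(2n+1)^{2m+1}}\frac{1}{e^{(2n+1)\pi(2z+1)/i}+1}.$$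
   Context: $\mathfrak H=\{z\in\mathbb C:\operatorname{Im} z>0\}$ is the upper half-plane; $\Gamma$ is Euler's gamma function and $\zeta$ the Riemann zeta function. For a positive integer $N$, $\varGamma_0(N)=\left\{\begin{pmatrix}a&b\\c&d\end{pmatrix}: a,b,c,d\in\mathbb Z,\ ad-bc=1,\ N\mid c\right\}$, acting on $\mathfrak H$ by $\hat\gamma z=\frac{az+b}{cz+d}$. The Epstein zeta function is $$E^{\varGamma_0(N)}(z,s)=\sum_{\hat\gamma\in B\backslash\varGamma_0(N)}[\operatorname{Im}(\hat\gamma z)]^s,\qquad z\in\mathfrak H,\ \operatorname{Re}s>1,$$ where $B$ is the subgroup of upper triangular matrices $\begin{pmatrix}*&*\\0&*\end{pmatrix}$ in $\varGamma_0(N)$. In particular $E^{\varGamma_0(1)}(z,s)=\frac{1}{2\zeta(2s)}\sum_{(m,n)\in\mathbb Z^2\setminus\{(0,0)\}}\frac{(\operatorname{Im}z)^s}{|mz+n|^{2s}}$. The symbol $\left(\frac{\partial}{\partial \operatorname{Im} z}\frac{1}{\operatorname{Im} z}\right)^{m}$ denotes the $m$-fold composition of the operator $f\mapsto\frac{\partial}{\partial\operatorname{Im} z}\left(\frac{f}{\operatorname{Im}z}\right)$ (partial derivative with $\operatorname{Re}z$ fixed), applied to the real-valued function of $z$ standing to its right. *)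

theory Defs
  imports "HOL-Analysis.Analysis" "HOL-Algebra.Coset"
begin

text \<open>The values of the Riemann zeta function on the half-plane \<open>Re s > 1\<close>, where it is given by its
  Dirichlet series. The definition is not meaningful for other arguments.\<close>

definition zeta :: "complex \<Rightarrow> complex" where
  "zeta s = (\<Sum>n. 1 / of_nat (Suc n) powr s)"

definition Gamma0 :: "nat \<Rightarrow> (int^2^2) monoid" where
  "Gamma0 N = \<lparr>carrier = {A. det A = 1 \<and> int N dvd A $ 2 $ 1}, mult = (**), one = mat 1\<rparr>"

definition upper_triangular :: "nat \<Rightarrow> (int^2^2) set" where
  "upper_triangular N = {A \<in> carrier (Gamma0 N). A $ 2 $ 1 = 0}"

definition mobius :: "int^2^2 \<Rightarrow> complex \<Rightarrow> complex" where
  "mobius A z = (of_int (A $ 1 $ 1) * z + of_int (A $ 1 $ 2)) /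
                (of_int (A $ 2 $ 1) * z + of_int (A $ 2 $ 2))"

text \<open>The cosets \<open>B \<gamma>\<close>, which form the set usually written \<open>B \ \<Gamma>\<^sub>0(N)\<close>, are the right cosets
  in the terminology of HOL-Algebra. The choice of a representative of a coset is immaterial by
  \<open>Im_mobius_rcoset\<close> below.\<close>

definition epstein_zeta :: "nat \<Rightarrow> complex \<Rightarrow> complex \<Rightarrow> complex" where
  "epstein_zeta N z s =
     (\<Sum>\<^sub>\<infinity>C \<in> rcosets\<^bsub>Gamma0 N\<^esub> (upper_triangular N).
        complex_of_real (Im (mobius (SOME A. A \<in> C) z)) powr s)"

text \<open>The operator \<open>f \<mapsto> \<partial>/\<partial>y (f / y)\<close> with \<open>y = Im z\<close> and \<open>Re z\<close> fixed.\<close>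

definition dy_inv_y :: "(complex \<Rightarrow> real) \<Rightarrow> complex \<Rightarrow> real" where
  "dy_inv_y f z = deriv (\<lambda>y. f (Complex (Re z) y) / y) (Im z)"

lemma matrix_matrix_mult_2:
  fixes A B :: "int^2^2"
  shows "(A ** B) $ i $ j = A $ i $ 1 * B $ 1 $ j + A $ i $ 2 * B $ 2 $ j"
  by (simp add: matrix_matrix_mult_def sum_2)

lemma group_Gamma0: "group (Gamma0 N)"
proof (rule groupI)
  show "\<exists>Y \<in> carrier (Gamma0 N). Y \<otimes>\<^bsub>Gamma0 N\<^esub> X = \<one>\<^bsub>Gamma0 N\<^esub>" if "X \<in> carrier (Gamma0 N)" for X
  proof -
    define Y :: "int^2^2" where "Y = vector [vector [X$2$2, - X$1$2], vector [- X$2$1, X$1$1]]"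
    have "Y \<in> carrier (Gamma0 N)"
      using that by (simp add: Gamma0_def Y_def det_2 mult.commute)
    moreover have "Y ** X = mat 1"
      using that
      by (simp add: Gamma0_def vec_eq_iff forall_2 matrix_matrix_mult_2 mat_def Y_def det_2
          algebra_simps)
    ultimately show ?thesis
      by (auto simp: Gamma0_def)
  qed
qed (simp_all add: Gamma0_def det_mul matrix_matrix_mult_2 matrix_mul_assoc, simp add: mat_def)

lemma subgroup_upper_triangular: "subgroup (upper_triangular N) (Gamma0 N)"
proof -
  interpret group "Gamma0 N" by (rule group_Gamma0)
  show ?thesis
  proof (rule subgroupI)
    show "upper_triangular N \<noteq> {}"
    proof -
      have "mat 1 \<in> upper_triangular N"
        using one_closed by (simp add: upper_triangular_def Gamma0_def) (simp add: mat_def)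
      then show ?thesis
        by blast
    qed
    show "inv\<^bsub>Gamma0 N\<^esub> A \<in> upper_triangular N" if "A \<in> upper_triangular N" for A
    proof -
      have A: "A \<in> carrier (Gamma0 N)" "A $ 2 $ 1 = 0" "det A = 1"
        using that by (auto simp: upper_triangular_def Gamma0_def)
      have "(inv\<^bsub>Gamma0 N\<^esub> A ** A) $ 2 $ 1 = 0"
        using l_inv[OF A(1)] by (simp add: Gamma0_def mat_def)
      then have "(inv\<^bsub>Gamma0 N\<^esub> A) $ 2 $ 1 = 0"
        using A(2,3) by (auto simp: matrix_matrix_mult_2 det_2)
      then show ?thesis
        using A(1) by (simp add: upper_triangular_def)
    qed
  qed (auto simp: upper_triangular_def Gamma0_def det_mul matrix_matrix_mult_2)
qed

lemma Im_mobius: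
  assumes "det A = 1"
  shows "Im (mobius A z) = Im z / (cmod (of_int (A $ 2 $ 1) * z + of_int (A $ 2 $ 2)))\<^sup>2"
proof -
  have "real_of_int (A$1$1 * A$2$2 - A$1$2 * A$2$1) = 1"
    using assms by (simp add: det_2)
  then have d: "real_of_int (A$1$1) * A$2$2 = 1 + real_of_int (A$1$2) * A$2$1"
    by simp
  have "A$1$1 * Im z * (A$2$1 * Re z + A$2$2) - (A$1$1 * Re z + A$1$2) * (A$2$1 * Im z)
      = Im z * (real_of_int (A$1$1) * A$2$2 - real_of_int (A$1$2) * A$2$1)"
    by (simp add: algebra_simps)
  also have "\<dots> = Im z"
    using d by simp
  finally show ?thesis
    by (simp add: mobius_def Im_divide cmod_def)
qed

lemma Im_mobius_rcoset:
  assumes "C \<in> rcosets\<^bsub>Gamma0 N\<^esub> (upper_triangular N)" "A \<in> C" "A' \<in> C"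
  shows "Im (mobius A z) = Im (mobius A' z)"
proof -
  obtain G where G: "G \<in> carrier (Gamma0 N)" "C = upper_triangular N #>\<^bsub>Gamma0 N\<^esub> G"
    using assms(1) by (auto simp: RCOSETS_def)
  have "Im (mobius X z) = Im (mobius G z)" if X: "X \<in> C" for X
  proof -
    obtain P where P: "P \<in> upper_triangular N" "X = P ** G"
      using X G(2) by (auto simp: r_coset_def Gamma0_def)
    have "P$1$1 * P$2$2 = 1"
      using P(1) by (auto simp: upper_triangular_def Gamma0_def det_2)
    then have "\<bar>P$2$2\<bar> = 1"
      by (auto simp: zmult_eq_1_iff)
    then have "cmod (of_int (P$2$2)) = 1"
      by (simp flip: of_int_abs)
    moreover have dets: "P$2$1 = 0" "det P = 1" "det G = 1"
      using P(1) G(1) by (auto simp: upper_triangular_def Gamma0_def)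
    moreover have "of_int (X$2$1) * z + of_int (X$2$2)
        = of_int (P$2$2) * (of_int (G$2$1) * z + of_int (G$2$2))"
      by (simp add: P(2) matrix_matrix_mult_2 dets(1) distrib_left mult.assoc)
    moreover have "det X = 1"
      by (simp add: P(2) det_mul dets)
    ultimately show ?thesis
      by (simp add: Im_mobius norm_mult)
  qed
  then show ?thesis
    using assms(2,3) by simp
qed

end

theory Submission
  imports Defs "HOL-Complex_Analysis.Cauchy_Integral_Formula"
begin

text \<open>Summing over cosets amounts to summing over coprime bottom rows up to sign. Multiplying by the
  appropriate zeta value turns the coprime sum into \<open>\<Sum>\<^bsub>c\<in>K, d\<in>\<int>\<^esub> 1/|cz + d|\<^bsup>2m+2\<^esup>\<close>, where \<open>K\<close> is the set
  of all positive integers for level 1 and of the odd ones for level 4. In the variable \<open>u = y\<^sup>2\<close>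
  the summand is, up to a factor \<open>c\<^bsup>-2m\<^esup>\<close>, the \<open>m\<close>-th derivative of \<open>1/((cx + d)\<^sup>2 + c\<^sup>2u)\<close>, and the operator
  \<open>f \<mapsto> \<partial>/\<partial>y (f/y)\<close> also becomes a plain derivative, because it maps \<open>y B(y\<^sup>2)\<close> to \<open>2 y B'(y\<^sup>2)\<close>.
  The series of the \<open>1/((cx + d)\<^sup>2 + c\<^sup>2u)\<close> is evaluated by the partial fraction expansion of the
  cotangent and may be differentiated termwise by holomorphy.\<close>

section \<open>Partial fractions of the cotangent\<close>

text \<open>The derivative of Gamma w * Gamma (1 - w) = pi / sin (pi w) is computed from both sides;
  uniqueness of derivatives and division by the nonzero product give the claim.\<close>

lemma Digamma_reflection_complex:
  fixes z :: complex
  assumes "z \<notin> \<int>"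
  shows "Digamma (1 - z) - Digamma z = of_real pi * cot (of_real pi * z)"
proof -
  have nz: "z \<notin> \<int>\<^sub>\<le>\<^sub>0" "1 - z \<notin> \<int>\<^sub>\<le>\<^sub>0"
    using assms minus_in_Ints_iff[of "1 - z"] Ints_diff[of 1 "1 - z"] nonpos_Ints_subset_Ints by auto
  have sin_nz: "sin (of_real pi * z) \<noteq> 0"
  proof
    assume "sin (of_real pi * z) = 0"
    then obtain n :: int where "of_real pi * z = of_real (of_int n * pi)"
      unfolding sin_eq_0 by blast
    then have "z = of_int n"
      by simp
    then show False
      using assms by simp
  qed
  have "((\<lambda>w. Gamma w * Gamma (1 - w)) has_field_derivative
          Gamma z * Gamma (1 - z) * (Digamma z - Digamma (1 - z))) (at z)"
    using nz by (auto intro!: derivative_eq_intros simp: algebra_simps)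
  moreover have "((\<lambda>w. Gamma w * Gamma (1 - w)) has_field_derivative
          - (of_real pi * of_real pi * cos (of_real pi * z) / (sin (of_real pi * z))\<^sup>2)) (at z)"
    unfolding Gamma_reflection_complex
    using sin_nz by (auto intro!: derivative_eq_intros simp: field_simps power2_eq_square)
  ultimately have "of_real pi / sin (of_real pi * z) * (Digamma z - Digamma (1 - z)) =
      - (of_real pi * of_real pi * cos (of_real pi * z) / (sin (of_real pi * z))\<^sup>2)"
    unfolding Gamma_reflection_complex by (rule DERIV_unique)
  moreover have "Digamma (1 - z) - Digamma z = - (sin (of_real pi * z) / of_real pi)
      * (of_real pi / sin (of_real pi * z) * (Digamma z - Digamma (1 - z)))"
    using sin_nz by simp
  ultimately show ?thesis
    using sin_nz by (simp add: cot_def power2_eq_square)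
qed

text \<open>In the difference of two Digamma series the harmonic terms and the Euler-Mascheroni
  constant cancel.\<close>

lemma Digamma_diff_sums:
  fixes a b :: complex
  assumes "a \<notin> \<int>" "b \<notin> \<int>"
  shows "(\<lambda>n. 1 / (a + of_nat n) - 1 / (b + of_nat n)) sums (Digamma b - Digamma a)"
proof -
  have D: "(\<lambda>n. inverse (of_nat (Suc n)) - inverse (c + of_nat n)) sums (Digamma c + euler_mascheroni)"
    if "c \<notin> \<int>" for c :: complex
    using summable_Digamma[of c] that summable_sums unfolding Digamma_def by fastforce
  show ?thesis
    using sums_diff[OF D[OF assms(2)] D[OF assms(1)]] by (simp add: field_simps)
qed

section \<open>Two-sided sums and the nome\<close>

lemma range_negative_int: "- {0::int..} = range (\<lambda>n. - 1 - int n)"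
proof (intro equalityI subsetI)
  fix d :: int
  assume "d \<in> - {0..}"
  then have "d = - 1 - int (nat (- 1 - d))"
    by simp
  then show "d \<in> range (\<lambda>n. - 1 - int n)"
    by blast
qed auto

lemma image_int_atLeast_0: "range int = {0..}"
  by (auto simp: image_iff intro: nonneg_int_cases)

text \<open>The negative half is indexed by -1 - n because 1 / (c - 1 - n) = - 1 / ((1 - c) + n) is
  a term of the Digamma series at 1 - c, ready for the reflection formula.\<close>

lemma has_sum_int_halves:
  fixes f :: "int \<Rightarrow> 'a::topological_comm_monoid_add"
  assumes "((\<lambda>n. f (int n)) has_sum s) UNIV" "((\<lambda>n. f (- 1 - int n)) has_sum t) UNIV"
  shows "(f has_sum (s + t)) UNIV"
proof -
  have "(f has_sum s) {0..}"
    unfolding image_int_atLeast_0[symmetric]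
    using assms(1) by (subst has_sum_reindex) (auto simp: o_def inj_on_def)
  moreover have "(f has_sum t) (- {0..})"
    unfolding range_negative_int
    using assms(2) by (subst has_sum_reindex) (auto simp: o_def inj_on_def)
  ultimately have "(f has_sum (s + t)) ({0..} \<union> - {0..})"
    by (rule has_sum_Un_disjoint) auto
  then show ?thesis
    by (simp only: Compl_partition)
qed

text \<open>The exponential is the inverse of the nome exp (2 pi i b), so - i is the limit of the
  cotangent as Im b tends to infinity and the other summand is the decaying remainder.\<close>

lemma cot_eq_exp:
  assumes "exp (2 * of_real pi * b / \<i>) \<noteq> 1"
  shows "cot (of_real pi * b) = - \<i> * (1 + 2 / (exp (2 * of_real pi * b / \<i>) - 1))"
proof -
  define E where "E = exp (- (\<i> * (of_real pi * b)))"
  have F: "exp (\<i> * (of_real pi * b)) = 1 / E" and nz: "E \<noteq> 0"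
    by (simp_all add: E_def exp_minus inverse_eq_divide)
  have "2 * of_real pi * b / \<i> = - (\<i> * (of_real pi * b)) + - (\<i> * (of_real pi * b))"
    by simp
  then have E2: "exp (2 * of_real pi * b / \<i>) = E\<^sup>2"
    unfolding E_def power2_eq_square by (simp only: exp_add)
  have ne: "E\<^sup>2 - 1 \<noteq> 0"
    using assms E2 by simp
  have "cot (of_real pi * b) = \<i> * ((1 / E + E) / (1 / E - E))"
    unfolding cot_def cos_exp_eq sin_exp_eq F E_def[symmetric]
    by (simp add: divide_simps mult.assoc[symmetric])
  also have "(1 / E + E) / (1 / E - E) = - ((E\<^sup>2 + 1) / (E\<^sup>2 - 1))"
  proof -
    have "1 / E + E = (E\<^sup>2 + 1) / E" "1 / E - E = - ((E\<^sup>2 - 1) / E)"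
      using nz by (simp_all add: field_simps power2_eq_square)
    then show ?thesis
      using nz by simp
  qed
  also have "(E\<^sup>2 + 1) / (E\<^sup>2 - 1) = 1 + 2 / (E\<^sup>2 - 1)"
    using ne by (simp add: field_simps)
  finally show ?thesis
    unfolding E2 by (simp add: algebra_simps)
qed

text \<open>With the nome \<open>q = exp (2\<pi>iz)\<close> this is \<open>q / (1 - q)\<close>.\<close>

definition nome_ratio :: "complex \<Rightarrow> complex" where
  "nome_ratio z = 1 / (exp (2 * of_real pi * z / \<i>) - 1)"

lemma norm_exp_nome: "norm (exp (2 * of_real pi * z / \<i>)) = exp (2 * pi * Im z)"
  by (simp add: Re_divide)

lemma exp_nome_neq_1: "Im z > 0 \<Longrightarrow> exp (2 * of_real pi * z / \<i>) \<noteq> 1"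
  using norm_exp_nome[of z] by (metis exp_eq_one_iff less_irrefl mult_pos_pos norm_one pi_gt_zero zero_less_numeral)

text \<open>The denominator factors as (a + d)(b + d) with a = X - iW and b = X + iW. Partial
  fractions turn each half of the sum into a Digamma difference, and reflection combines the halves
  into cot (pi a) - cot (pi b).\<close>

lemma partial_fraction_sums:
  fixes X :: real and W :: complex
  assumes W: "Re W > 0"
  defines "f \<equiv> \<lambda>d::int. 1 / ((of_real X + of_int d)\<^sup>2 + W\<^sup>2)"
  obtains s t where "(\<lambda>n. f (int n)) sums s" "(\<lambda>n. f (- 1 - int n)) sums t"
    "s + t = of_real pi / W * (1 + nome_ratio (of_real X + \<i> * W) + nome_ratio (- of_real X + \<i> * W))"
proof -
  define a b where "a = of_real X - \<i> * W" and "b = of_real X + \<i> * W"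
  have Im: "Im a < 0" "Im b > 0" "Im (1 - a) > 0" "Im (1 - b) < 0"
    using W by (simp_all add: a_def b_def)
  have notint: "c \<notin> \<int>" if "Im c \<noteq> 0" for c
    using that by (auto elim!: Ints_cases)
  have ni: "a \<notin> \<int>" "b \<notin> \<int>" "1 - a \<notin> \<int>" "1 - b \<notin> \<int>"
    using Im by (auto intro!: notint)
  have Wnz: "W \<noteq> 0" using W by auto
  have nz: "a + of_int d \<noteq> 0" "b + of_int d \<noteq> 0" for d
    using ni(1,2) by (metis Ints_minus Ints_of_int add_eq_0_iff2 minus_minus)+
  have f_eq: "f d = (1 / (a + of_int d) - 1 / (b + of_int d)) / (2 * \<i> * W)" for d
  proof -
    have "(of_real X + of_int d)\<^sup>2 + W\<^sup>2 = (a + of_int d) * (b + of_int d)"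
      by (simp add: a_def b_def algebra_simps power2_eq_square)
    moreover have "1 / (a + of_int d) - 1 / (b + of_int d) = (b - a) / ((a + of_int d) * (b + of_int d))"
      using nz[of d] by (simp add: field_simps)
    moreover have "b - a = 2 * \<i> * W" by (simp add: a_def b_def)
    ultimately show ?thesis using Wnz by (simp add: f_def)
  qed
  have 1: "(\<lambda>n. f (int n)) sums ((Digamma b - Digamma a) / (2 * \<i> * W))"
    unfolding f_eq using sums_divide[OF Digamma_diff_sums[OF ni(1,2)]] by simp
  have "f (- 1 - int n) = (1 / ((1 - b) + of_nat n) - 1 / ((1 - a) + of_nat n)) / (2 * \<i> * W)" for n
  proof -
    have *: "1 / (c + of_int (- 1 - int n)) = - (1 / ((1 - c) + of_nat n))" for c :: complex
      by (simp add: minus_divide_right del: minus_divide_left)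
    show ?thesis
      unfolding f_eq * by simp
  qed
  then have 2: "(\<lambda>n. f (- 1 - int n)) sums ((Digamma (1 - a) - Digamma (1 - b)) / (2 * \<i> * W))"
    using sums_divide[OF Digamma_diff_sums[OF ni(4,3)]] by simp
  have cb: "cot (of_real pi * b) = - \<i> * (1 + 2 * nome_ratio b)"
    using cot_eq_exp[OF exp_nome_neq_1[OF Im(2)]] by (simp add: nome_ratio_def)
  \<comment> \<open>Here Im a < 0, so oddness of the cotangent moves the argument to -a in the upper
    half-plane.\<close>
  have ca: "cot (of_real pi * a) = \<i> * (1 + 2 * nome_ratio (- a))"
    using cot_eq_exp[OF exp_nome_neq_1[of "- a"]] Im(1) by (simp add: nome_ratio_def cot_def)
  have "(Digamma b - Digamma a) / (2 * \<i> * W) + (Digamma (1 - a) - Digamma (1 - b)) / (2 * \<i> * W)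
    = ((Digamma (1 - a) - Digamma a) - (Digamma (1 - b) - Digamma b)) / (2 * \<i> * W)"
    by (simp add: diff_divide_distrib add_divide_distrib)
  also have "\<dots> = of_real pi * (cot (of_real pi * a) - cot (of_real pi * b)) / (2 * \<i> * W)"
    using ni by (simp add: Digamma_reflection_complex right_diff_distrib)
  also have "\<dots> = of_real pi / W * (1 + nome_ratio b + nome_ratio (- a))"
    unfolding ca cb using Wnz by (simp add: field_simps)
  finally show ?thesis
    using that[OF 1 2] by (simp add: a_def b_def)
qed

text \<open>For real w the terms are positive, which upgrades the convergent series to unordered
  sums. The points X + iw and -X + iw have conjugate nomes, whence twice a real part.\<close>

lemma has_sum_int_real:
  fixes X w :: real
  assumes "w > 0"
  shows "((\<lambda>d::int. 1 / ((X + of_int d)\<^sup>2 + w\<^sup>2)) has_sum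
     (pi / w * (1 + 2 * Re (nome_ratio (Complex X w))))) UNIV"
proof -
  let ?f = "\<lambda>d::int. 1 / ((X + of_int d)\<^sup>2 + w\<^sup>2)"
  obtain s t where st: "(\<lambda>n. complex_of_real (?f (int n))) sums s" "(\<lambda>n. complex_of_real (?f (- 1 - int n))) sums t"
    and eq: "s + t = of_real pi / w * (1 + nome_ratio (of_real X + \<i> * w) + nome_ratio (- of_real X + \<i> * w))"
    using partial_fraction_sums[of "of_real w" X] assms by auto
  have "nome_ratio (- of_real X + \<i> * w) = cnj (nome_ratio (Complex X w))"
    by (simp add: nome_ratio_def exp_cnj complex_eq_iff[of _ "cnj _"] Complex_eq)
       (simp add: algebra_simps)
  then have "Re (s + t) = pi / w * (1 + 2 * Re (nome_ratio (Complex X w)))"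
    unfolding eq Complex_eq by simp
  moreover have "(\<lambda>n. ?f (int n)) sums Re s" "(\<lambda>n. ?f (- 1 - int n)) sums Re t"
    using st[THEN sums_Re] by simp_all
  then have "(?f has_sum (Re s + Re t)) UNIV"
    by (intro has_sum_int_halves sums_nonneg_imp_has_sum) auto
  ultimately show ?thesis by simp
qed

section \<open>Cosets, coprime pairs and zeta values\<close>

definition bottom_row :: "int^2^2 \<Rightarrow> int \<times> int" where
  "bottom_row A = (A $ 2 $ 1, A $ 2 $ 2)"

definition row_class :: "nat \<Rightarrow> int \<times> int \<Rightarrow> (int^2^2) set" where
  "row_class N p = {A \<in> carrier (Gamma0 N). bottom_row A = p \<or> bottom_row A = - p}"

text \<open>An upper triangular P of determinant 1 multiplies the bottom row by its lower right
  entry, which is 1 or -1. Conversely, proportional bottom rows of A and G force the lower left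
  entry of A times the inverse of G to vanish.\<close>

lemma rcoset_eq_row_class:
  assumes G: "G \<in> carrier (Gamma0 N)"
  shows "upper_triangular N #>\<^bsub>Gamma0 N\<^esub> G = row_class N (bottom_row G)"
proof -
  interpret group "Gamma0 N" by (rule group_Gamma0)
  have mult: "A \<otimes>\<^bsub>Gamma0 N\<^esub> B = A ** B" for A B
    by (simp add: Gamma0_def)
  show ?thesis
  proof (intro equalityI subsetI)
    fix A assume "A \<in> upper_triangular N #>\<^bsub>Gamma0 N\<^esub> G"
    then obtain P where P: "P \<in> upper_triangular N" "A = P ** G"
      by (auto simp: r_coset_def mult)
    have Pc: "P \<in> carrier (Gamma0 N)" "P$2$1 = 0" "P$1$1 * P$2$2 = 1"
      using P(1) by (auto simp: upper_triangular_def Gamma0_def det_2)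
    then have "P$2$2 = 1 \<or> P$2$2 = - 1"
      by (auto simp: zmult_eq_1_iff)
    moreover have "A \<in> carrier (Gamma0 N)"
      using m_closed[OF Pc(1) G] by (simp add: P(2) mult)
    ultimately show "A \<in> row_class N (bottom_row G)"
      using Pc(2) by (auto simp: row_class_def bottom_row_def P(2) matrix_matrix_mult_2)
  next
    fix A assume "A \<in> row_class N (bottom_row G)"
    then have A: "A \<in> carrier (Gamma0 N)"
      and row: "bottom_row A = bottom_row G \<or> bottom_row A = - bottom_row G"
      by (simp_all add: row_class_def)
    obtain s where s: "A$2$1 = s * G$2$1" "A$2$2 = s * G$2$2"
      using row that[of 1] that[of "- 1"] by (auto simp: bottom_row_def)
    define P where "P = A \<otimes>\<^bsub>Gamma0 N\<^esub> inv\<^bsub>Gamma0 N\<^esub> G"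
    have Pc: "P \<in> carrier (Gamma0 N)"
      unfolding P_def using A G by simp
    have PG: "A = P ** G"
      using inv_solve_right[of P A "G"] A G Pc by (simp add: P_def m_assoc flip: mult)
    \<comment> \<open>Inserting det G = 1 exhibits the entry as the determinant of the two bottom
      rows, without an explicit inverse of G.\<close>
    have "P$2$1 = P$2$1 * det G"
      using G by (simp add: Gamma0_def)
    also have "\<dots> = A$2$1 * G$2$2 - A$2$2 * G$2$1"
      unfolding PG by (simp add: det_2 matrix_matrix_mult_2 algebra_simps)
    also have "\<dots> = 0"
      using s by simp
    finally have "P \<in> upper_triangular N"
      using Pc by (simp add: upper_triangular_def)
    then show "A \<in> upper_triangular N #>\<^bsub>Gamma0 N\<^esub> G"
      unfolding r_coset_def mult using PG by blast
  qed
qed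

lemma coprime_bottom_row:
  assumes "A \<in> carrier (Gamma0 N)"
  shows "coprime (A$2$1) (A$2$2)" "int N dvd A$2$1"
proof -
  have "A$1$1 * A$2$2 - A$1$2 * A$2$1 = 1"
    using assms by (simp add: Gamma0_def det_2)
  then show "coprime (A$2$1) (A$2$2)"
    by (intro coprimeI) (metis dvd_diff dvd_mult)
qed (use assms in \<open>simp add: Gamma0_def\<close>)

lemma exists_matrix_with_bottom_row:
  assumes "coprime c d" "int N dvd c"
  obtains A where "A \<in> carrier (Gamma0 N)" "bottom_row A = (c, d)"
proof -
  obtain u v where uv: "u * c + v * d = 1"
    using bezout_int[of c d] assms(1) by auto
  define A :: "int^2^2" where "A = vector [vector [v, - u], vector [c, d]]"
  have "A \<in> carrier (Gamma0 N)" "bottom_row A = (c, d)"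
    using uv assms(2) by (simp_all add: A_def Gamma0_def det_2 bottom_row_def)
  then show ?thesis
    using that by blast
qed

text \<open>\<open>R\<close> is any choice of one row from each pair of opposite admissible rows. It
  stays a parameter because level 1 normalises the sign by c and level 4 by d.\<close>

lemma epstein_zeta_eq_infsum:
  assumes z: "Im z > 0"
    and R: "\<And>c d. (c, d) \<in> R \<Longrightarrow> coprime c d \<and> int N dvd c"
    and sign: "\<And>c d. coprime c d \<Longrightarrow> int N dvd c \<Longrightarrow> (c, d) \<in> R \<longleftrightarrow> (- c, - d) \<notin> R"
  shows "epstein_zeta N z (of_nat k) =
    (\<Sum>\<^sub>\<infinity>(c, d)\<in>R. complex_of_real ((Im z / (cmod (of_int c * z + of_int d))\<^sup>2) ^ k))"
proof -
  have sign': "p \<in> R \<Longrightarrow> - p \<notin> R" for p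
    using R sign by (cases p) auto
  have ex: "\<exists>A\<in>carrier (Gamma0 N). bottom_row A = p" if "p \<in> R" for p
    using that R exists_matrix_with_bottom_row by (metis surj_pair)
  have bij: "bij_betw (row_class N) R (rcosets\<^bsub>Gamma0 N\<^esub> (upper_triangular N))"
  proof (rule bij_betw_imageI)
    show "inj_on (row_class N) R"
    proof (rule inj_onI)
      fix p q assume pq: "p \<in> R" "q \<in> R" "row_class N p = row_class N q"
      obtain A where A: "A \<in> carrier (Gamma0 N)" "bottom_row A = p"
        using ex[OF pq(1)] by blast
      then have "A \<in> row_class N q"
        using pq(3) by (auto simp: row_class_def)
      then have "p = q \<or> p = - q"
        using A by (simp add: row_class_def)
      then show "p = q"
        using sign'[OF pq(2)] pq(1) by blast
    qed
    show "row_class N ` R = rcosets\<^bsub>Gamma0 N\<^esub> (upper_triangular N)"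
    proof (intro equalityI subsetI)
      fix C assume "C \<in> row_class N ` R"
      then obtain p where p: "p \<in> R" "C = row_class N p"
        by blast
      obtain A where "A \<in> carrier (Gamma0 N)" "bottom_row A = p"
        using ex[OF p(1)] by blast
      then show "C \<in> rcosets\<^bsub>Gamma0 N\<^esub> (upper_triangular N)"
        unfolding RCOSETS_def using rcoset_eq_row_class p(2) by blast
    next
      fix C assume "C \<in> rcosets\<^bsub>Gamma0 N\<^esub> (upper_triangular N)"
      then obtain G where G: "G \<in> carrier (Gamma0 N)" "C = row_class N (bottom_row G)"
        unfolding RCOSETS_def using rcoset_eq_row_class by blast
      have "bottom_row G \<in> R \<or> - bottom_row G \<in> R"
        using sign[OF coprime_bottom_row[OF G(1)]] by (auto simp: bottom_row_def)
      moreover have "row_class N (- bottom_row G) = row_class N (bottom_row G)"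
        by (auto simp: row_class_def)
      ultimately show "C \<in> row_class N ` R"
        using G(2) by (metis image_eqI)
    qed
  qed
  have "epstein_zeta N z (of_nat k) =
    (\<Sum>\<^sub>\<infinity>p\<in>R. complex_of_real (Im (mobius (SOME A. A \<in> row_class N p) z)) powr of_nat k)"
    unfolding epstein_zeta_def by (rule infsum_reindex_bij_betw[OF bij, symmetric])
  also have "\<dots> = (\<Sum>\<^sub>\<infinity>(c, d)\<in>R. complex_of_real ((Im z / (cmod (of_int c * z + of_int d))\<^sup>2) ^ k))"
  proof (rule infsum_cong, safe)
    fix c d assume cd: "(c, d) \<in> R"
    define A where "A = (SOME A. A \<in> row_class N (c, d))"
    have "\<exists>A. A \<in> row_class N (c, d)"
      using ex[OF cd] by (auto simp: row_class_def)
    then have "A \<in> row_class N (c, d)"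
      unfolding A_def by (rule someI_ex)
    then have A: "det A = 1" "A$2$1 = c \<and> A$2$2 = d \<or> A$2$1 = - c \<and> A$2$2 = - d"
      by (auto simp: row_class_def Gamma0_def bottom_row_def)
    from A(2) have "cmod (of_int (A$2$1) * z + of_int (A$2$2)) = cmod (of_int c * z + of_int d)"
      using norm_minus_cancel[of "of_int c * z + of_int d"] by auto
    then have Im: "Im (mobius A z) = Im z / (cmod (of_int c * z + of_int d))\<^sup>2"
      by (simp add: Im_mobius[OF A(1)])
    have "c \<noteq> 0 \<or> d \<noteq> 0"
      using R[OF cd] by auto
    then have "of_int c * z + of_int d \<noteq> 0"
      using z by (auto simp: complex_eq_iff)
    \<comment> \<open>A nonzero base makes \<open>powr\<close> agree with the ordinary power even
      for \<open>k\<close> = 0, since \<open>0 powr 0\<close> is 0 but \<open>0 ^ 0\<close> is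
      1.\<close>
    then have "Im (mobius A z) \<noteq> 0"
      using z by (simp add: Im)
    then show "complex_of_real (Im (mobius (SOME A. A \<in> row_class N (c, d)) z)) powr of_nat k
      = complex_of_real ((Im z / (cmod (of_int c * z + of_int d))\<^sup>2) ^ k)"
      unfolding A_def[symmetric] by (simp add: powr_nat' flip: Im)
  qed
  finally show ?thesis .
qed

text \<open>Every pair with first entry in \<open>K\<close> is a unique multiple, by an element of \<open>K\<close>, of a coprime pair.\<close>

lemma has_sum_coprime_pairs:
  fixes F :: "nat \<times> int \<Rightarrow> real" and K :: "nat set"
  assumes K: "K = {n. n > 0 \<and> coprime n l}"
    and hom: "\<And>g c d. g > 0 \<Longrightarrow> F (g * c, int g * d) = F (c, d) / real g ^ j"
    and F: "(F has_sum L) (K \<times> UNIV)"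
    and Z: "((\<lambda>g. 1 / real g ^ j) has_sum Z) K"
  shows "(F has_sum (L / Z)) {(c, d). c \<in> K \<and> coprime (int c) d}"
proof -
  let ?P = "{(c, d). c \<in> K \<and> coprime (int c) d}"
  have 1: "1 \<in> K"
    by (simp add: K)
  have "F summable_on ?P"
    using F by (rule summable_on_subset_banach[OF has_sum_imp_summable]) auto
  then obtain S where S: "(F has_sum S) ?P"
    by (auto simp: summable_on_def)
  \<comment> \<open>The inverse bijection splits off the gcd. Both factors of an element of
    \<open>K\<close> remain prime to \<open>l\<close>, so the common factor and the reduced first
    entry lie in \<open>K\<close> again.\<close>
  have "((\<lambda>(g, p). F p / real g ^ j) has_sum L) (K \<times> ?P) \<longleftrightarrow> (F has_sum L) (K \<times> UNIV)"
  proof (rule has_sum_reindex_bij_witness[where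
      j = "\<lambda>(g, (c, d)). (g * c, int g * d)" and
      i = "\<lambda>(n, d). (nat (gcd (int n) d), (nat (int n div gcd (int n) d), d div gcd (int n) d))"])
    fix b :: "nat \<times> int" assume "b \<in> K \<times> UNIV"
    then obtain n d where b: "b = (n, d)" "n \<in> K" by auto
    define g where "g = gcd (int n) d"
    have n: "n > 0" "coprime n l" using b K by auto
    then have g: "g > 0" "g dvd int n" "g dvd d" by (simp_all add: g_def)
    obtain n' d' where n': "int n = g * n'" and d': "d = g * d'"
      using g(2,3) by (auto elim!: dvdE)
    have "n' > 0" using n' n(1) g(1) by (metis of_nat_0_less_iff zero_less_mult_pos)
    then have nn: "n = nat g * nat n'" using n' g(1)
      by (metis less_imp_le nat_int nat_mult_distrib)
    have cop: "coprime n' d'"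
    proof -
      have "g = gcd (g * n') (g * d')"
        using g_def n' d' by simp
      also have "\<dots> = g * gcd n' d'"
        using g(1) by (simp add: gcd_mult_distrib_int[symmetric])
      finally show ?thesis
        using g(1) by (simp add: coprime_iff_gcd_eq_1)
    qed
    have inv: "(\<lambda>(n, d). (nat (gcd (int n) d), (nat (int n div gcd (int n) d), d div gcd (int n) d))) b
      = (nat g, (nat n', d'))"
      using g(1) by (simp add: b(1) flip: g_def) (simp add: n' d')
    show "(\<lambda>(g, (c, d)). (g * c, int g * d)) ((\<lambda>(n, d). (nat (gcd (int n) d), (nat (int n div gcd (int n) d), d div gcd (int n) d))) b) = b"
      unfolding inv using g(1) nn d' b(1) by simp
    show "(\<lambda>(n, d). (nat (gcd (int n) d), (nat (int n div gcd (int n) d), d div gcd (int n) d))) b \<in> K \<times> ?P"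
      unfolding inv using g(1) n nn \<open>n' > 0\<close> cop by (auto simp: K)
  next
    fix a :: "nat \<times> nat \<times> int" assume "a \<in> K \<times> ?P"
    then obtain g c d where a: "a = (g, (c, d))" "g > 0" "coprime g l" "c > 0" "coprime c l" "coprime (int c) d"
      by (auto simp: K)
    have "gcd (int (g * c)) (int g * d) = int g"
      using a(2,6) by (simp add: gcd_mult_distrib_int[symmetric] coprime_imp_gcd_eq_1)
    then show "(\<lambda>(n, d). (nat (gcd (int n) d), (nat (int n div gcd (int n) d), d div gcd (int n) d)))
       ((\<lambda>(g, (c, d)). (g * c, int g * d)) a) = a"
      using a(2) by (simp add: a(1))
    show "(\<lambda>(g, (c, d)). (g * c, int g * d)) a \<in> K \<times> UNIV"
      using a by (simp add: K)
    show "F ((\<lambda>(g, (c, d)). (g * c, int g * d)) a) = (\<lambda>(g, p). F p / real g ^ j) a"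
      using a(2) by (simp add: a(1) hom)
  qed simp
  then have "((\<lambda>(g, p). F p / real g ^ j) has_sum L) (K \<times> ?P)"
    using F by simp
  \<comment> \<open>Summing over the coprime pairs first leaves S / g^j for each g, hence L = S *
    Z.\<close>
  then have "((\<lambda>g. S / real g ^ j) has_sum L) K"
    by (rule has_sum_SigmaD) (use has_sum_cmult_left[OF S, of "1 / real _ ^ j"] in simp)
  moreover have "((\<lambda>g. S / real g ^ j) has_sum (S * Z)) K"
    using has_sum_cmult_right[OF Z, of S] by simp
  ultimately have L: "L = S * Z"
    by (rule has_sum_unique)
  \<comment> \<open>The term g = 1 alone shows Z >= 1, so division by Z is legitimate.\<close>
  have "(\<Sum>g\<in>{1}. 1 / real g ^ j) \<le> Z"
    by (rule finite_sum_le_has_sum[OF Z]) (use 1 in auto)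
  then have "Z \<noteq> 0"
    by simp
  then show ?thesis
    using S L by simp
qed

section \<open>Zeta values as real unordered sums\<close>

lemma has_sum_real_zeta:
  assumes "j \<ge> 2"
  shows "((\<lambda>n::nat. 1 / real n ^ j) has_sum Re (zeta (of_nat j))) {n. n > 0}"
    and "zeta (of_nat j) = of_real (Re (zeta (of_nat j)))"
proof -
  have summ: "summable (\<lambda>n. 1 / real (Suc n) ^ j)"
    using inverse_power_summable[OF assms, where 'a = real] by (subst summable_Suc_iff) (simp add: inverse_eq_divide)
  have *: "zeta (of_nat j) = of_real (\<Sum>n. 1 / real (Suc n) ^ j)"
    unfolding zeta_def suminf_of_real[OF summ]
    by (intro arg_cong[where f = suminf] ext) (simp add: powr_nat' del: of_nat_Suc)
  then show "zeta (of_nat j) = of_real (Re (zeta (of_nat j)))"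
    by simp
  have "((\<lambda>n. 1 / real (Suc n) ^ j) has_sum Re (zeta (of_nat j))) UNIV"
    unfolding * Re_complex_of_real by (intro sums_nonneg_imp_has_sum summable_sums summ) auto
  also have "?this \<longleftrightarrow> ((\<lambda>n::nat. 1 / real n ^ j) has_sum Re (zeta (of_nat j))) {n. n > 0}"
    by (rule has_sum_reindex_bij_witness[where i = "\<lambda>n. n - 1" and j = Suc]) auto
  finally show "((\<lambda>n::nat. 1 / real n ^ j) has_sum Re (zeta (of_nat j))) {n. n > 0}" .
qed

text \<open>The even terms sum to zeta(j) / 2^j; removing them removes the Euler factor at
  2.\<close>

lemma has_sum_real_zeta_odd:
  assumes "j \<ge> 2"
  shows "((\<lambda>n::nat. 1 / real n ^ j) has_sum ((1 - 1 / 2 ^ j) * Re (zeta (of_nat j)))) {n. n > 0 \<and> odd n}"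
proof -
  let ?Z = "Re (zeta (of_nat j))"
  have "((\<lambda>n::nat. 1 / 2 ^ j * (1 / real n ^ j)) has_sum (1 / 2 ^ j * ?Z)) {n. n > 0}"
    by (intro has_sum_cmult_right has_sum_real_zeta assms)
  also have "?this \<longleftrightarrow> ((\<lambda>n::nat. 1 / real n ^ j) has_sum (1 / 2 ^ j * ?Z)) {n. n > 0 \<and> even n}"
    by (rule has_sum_reindex_bij_witness[where i = "\<lambda>n. n div 2" and j = "\<lambda>n. 2 * n"])
       (auto simp: power_mult_distrib elim!: evenE)
  finally have even: "((\<lambda>n::nat. 1 / real n ^ j) has_sum (1 / 2 ^ j * ?Z)) {n. n > 0 \<and> even n}" .
  have "((\<lambda>n::nat. 1 / real n ^ j) has_sum (?Z - 1 / 2 ^ j * ?Z)) ({n. n > 0} - {n. n > 0 \<and> even n})"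
    by (intro has_sum_Diff has_sum_real_zeta assms even) auto
  also have "{n. n > 0} - {n. n > 0 \<and> even n} = {n::nat. n > 0 \<and> odd n}"
    by auto
  finally show ?thesis
    by (simp add: left_diff_distrib)
qed

section \<open>Iterating the operator by holomorphic differentiation\<close>

text \<open>The recurrence is required on an open set because each further derivative needs the
  previous identity in a neighbourhood of the point.\<close>

lemma higher_deriv_eqI:
  assumes "open S" and "u \<in> S"
    and der: "\<And>n u. u \<in> S \<Longrightarrow> (F n has_field_derivative F (Suc n) u) (at u)"
  shows "(deriv ^^ n) (F 0) u = F n u"
  using \<open>u \<in> S\<close>
proof (induction n arbitrary: u)
  case (Suc n)
  have "eventually (\<lambda>v. (deriv ^^ n) (F 0) v = F n v) (nhds u)"
    using eventually_nhds_in_open[OF \<open>open S\<close> Suc.prems] by eventually_elim (rule Suc.IH)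
  then have "deriv ((deriv ^^ n) (F 0)) u = deriv (F n) u"
    by (rule deriv_cong_ev) simp
  also have "\<dots> = F (Suc n) u"
    by (rule DERIV_imp_deriv[OF der[OF Suc.prems]])
  finally show ?case
    by simp
qed simp

lemma higher_deriv_inverse_affine:
  fixes a b u :: complex
  assumes "a + b * u \<noteq> 0"
  shows "(deriv ^^ n) (\<lambda>u. 1 / (a + b * u)) u = (- b) ^ n * fact n / (a + b * u) ^ Suc n"
proof -
  let ?F = "\<lambda>n u. (- b) ^ n * fact n / (a + b * u) ^ Suc n"
  have "open {u. a + b * u \<noteq> 0}"
    by (intro open_Collect_neq continuous_intros)
  moreover have "(?F n has_field_derivative ?F (Suc n) v) (at v)" if "v \<in> {u. a + b * u \<noteq> 0}" for n v
  proof -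
    define w where "w = a + b * v"
    have w: "w \<noteq> 0"
      using that by (simp add: w_def)
    have "(?F n has_field_derivative - ((- b) ^ n * fact n * (of_nat (Suc n) * w ^ n * b)) / (w ^ Suc n * w ^ Suc n)) (at v)"
      unfolding w_def using that
      by (auto intro!: derivative_eq_intros simp del: power_Suc of_nat_Suc)
    also have "- ((- b) ^ n * fact n * (of_nat (Suc n) * w ^ n * b)) / (w ^ Suc n * w ^ Suc n)
        = (- b) ^ Suc n * fact (Suc n) / w ^ Suc (Suc n)"
      using w by (simp add: field_simps)
    finally show ?thesis
      by (simp only: w_def)
  qed
  ultimately have "(deriv ^^ n) (?F 0) u = ?F n u"
    using assms by (intro higher_deriv_eqI) auto
  then show ?thesis
    by simp
qed

text \<open>The exponents -a, -a - 1, ... multiply up to a signed rising factorial. For a = 1/2 this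
  is the source of Gamma(m + 1/2).\<close>

lemma higher_deriv_powr:
  fixes u a :: complex
  assumes "u \<notin> \<real>\<^sub>\<le>\<^sub>0"
  shows "(deriv ^^ n) (\<lambda>u. u powr (- a)) u = (- 1) ^ n * pochhammer a n * u powr (- a - of_nat n)"
proof -
  let ?F = "\<lambda>n u. (- 1) ^ n * pochhammer a n * u powr (- a - of_nat n)"
  have "(?F n has_field_derivative ?F (Suc n) v) (at v)" if "v \<in> - \<real>\<^sub>\<le>\<^sub>0" for n v
  proof -
    have "(?F n has_field_derivative (- 1) ^ n * pochhammer a n * ((- a - of_nat n) * v powr (- a - of_nat n - 1))) (at v)"
      using that by (intro DERIV_cmult has_field_derivative_powr) auto
    also have "(- 1) ^ n * pochhammer a n * ((- a - of_nat n) * v powr (- a - of_nat n - 1)) = ?F (Suc n) v"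
      by (simp add: pochhammer_Suc algebra_simps)
    finally show ?thesis .
  qed
  then have "(deriv ^^ n) (?F 0) u = ?F n u"
    using assms by (intro higher_deriv_eqI[of "- \<real>\<^sub>\<le>\<^sub>0"]) (auto simp: open_Compl)
  then show ?thesis
    by simp
qed

text \<open>Division by y cancels the prefactor, and the chain rule for y^2 restores it together
  with a factor 2. Holomorphy of \<open>B\<close> supplies all derivatives; openness of
  \<open>S\<close> keeps the induction hypothesis valid near y.\<close>

lemma funpow_dy_inv_y:
  assumes S: "open S" and B: "B holomorphic_on S"
    and g: "\<And>y. y > 0 \<Longrightarrow> of_real (y\<^sup>2) \<in> S \<Longrightarrow> g (Complex x y) = y * Re (B (of_real (y\<^sup>2)))"
    and y: "y > 0" "of_real (y\<^sup>2) \<in> S"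
  shows "(dy_inv_y ^^ n) g (Complex x y) = y * 2 ^ n * Re ((deriv ^^ n) B (of_real (y\<^sup>2)))"
  using y
proof (induction n arbitrary: y)
  case 0
  then show ?case
    using g by simp
next
  case (Suc n)
  let ?D = "(deriv ^^ n) B"
  have "open {t. t > 0 \<and> complex_of_real (t\<^sup>2) \<in> S}"
  proof -
    have "open ((\<lambda>t. complex_of_real (t\<^sup>2)) -` S)"
      by (intro open_vimage S continuous_intros)
    then have "open ({0<..} \<inter> (\<lambda>t. complex_of_real (t\<^sup>2)) -` S)"
      by (intro open_Int open_greaterThan)
    also have "{0<..} \<inter> (\<lambda>t. complex_of_real (t\<^sup>2)) -` S = {t. t > 0 \<and> complex_of_real (t\<^sup>2) \<in> S}"
      by auto
    finally show ?thesis .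
  qed
  then have "eventually (\<lambda>t. t \<in> {t. t > 0 \<and> complex_of_real (t\<^sup>2) \<in> S}) (nhds y)"
    using Suc.prems by (intro eventually_nhds_in_open) auto
  then have "eventually (\<lambda>t. (dy_inv_y ^^ n) g (Complex x t) / t = 2 ^ n * Re (?D (of_real (t\<^sup>2)))) (nhds y)"
    by eventually_elim (use Suc.IH in auto)
  then have "dy_inv_y ((dy_inv_y ^^ n) g) (Complex x y) = deriv (\<lambda>t. 2 ^ n * Re (?D (of_real (t\<^sup>2)))) y"
    unfolding dy_inv_y_def complex.sel by (rule deriv_cong_ev) simp
  also have "\<dots> = 2 ^ n * (2 * y * Re ((deriv ^^ Suc n) B (of_real (y\<^sup>2))))"
  proof (rule DERIV_imp_deriv, rule DERIV_cmult)
    have "(?D has_field_derivative (deriv ^^ Suc n) B (of_real (y\<^sup>2))) (at (of_real (y\<^sup>2)))"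
      by (rule has_field_derivative_higher_deriv[OF B S Suc.prems(2)])
    then have "((\<lambda>w. ?D (w\<^sup>2)) has_field_derivative (deriv ^^ Suc n) B (of_real (y\<^sup>2)) * (2 * of_real y)) (at (of_real y))"
      by (intro DERIV_chain2[where f = ?D]) (auto intro!: derivative_eq_intros simp del: funpow.simps)
    then have "((\<lambda>t. ?D ((of_real t)\<^sup>2)) has_vector_derivative (deriv ^^ Suc n) B (of_real (y\<^sup>2)) * (2 * of_real y)) (at y)"
      by (rule has_vector_derivative_real_field)
    then have "((\<lambda>t. Re (?D ((of_real t)\<^sup>2))) has_field_derivative Re ((deriv ^^ Suc n) B (of_real (y\<^sup>2)) * (2 * of_real y))) (at y)"
      by (rule has_field_derivative_Re)
    then show "((\<lambda>t. Re (?D (of_real (t\<^sup>2)))) has_field_derivative 2 * y * Re ((deriv ^^ Suc n) B (of_real (y\<^sup>2)))) (at y)"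
      by (simp add: mult_ac del: funpow.simps)
  qed
  finally show ?case
    by simp
qed

text \<open>The M-test gives uniform convergence along the finite subsets of \<open>I\<close>.
  Holomorphy and all derivatives pass to this limit, and a limit along finite subsets is exactly
  what \<open>has_sum\<close> means.\<close>

lemma holomorphic_on_infsum:
  fixes f :: "'a \<Rightarrow> complex \<Rightarrow> complex"
  assumes S: "open S"
    and f: "\<And>i. i \<in> I \<Longrightarrow> f i holomorphic_on S"
    and M: "\<And>i u. i \<in> I \<Longrightarrow> u \<in> S \<Longrightarrow> norm (f i u) \<le> M i" "M summable_on I"
  shows "(\<lambda>u. \<Sum>\<^sub>\<infinity>i\<in>I. f i u) holomorphic_on S"
    and "u \<in> S \<Longrightarrow> ((\<lambda>i. (deriv ^^ n) (f i) u) has_sum (deriv ^^ n) (\<lambda>u. \<Sum>\<^sub>\<infinity>i\<in>I. f i u) u) I"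
proof -
  let ?A = "\<lambda>u. \<Sum>\<^sub>\<infinity>i\<in>I. f i u" and ?F = "finite_subsets_at_top I"
  have lim: "uniform_limit S (\<lambda>X u. \<Sum>i\<in>X. f i u) ?A ?F"
    by (rule Weierstrass_m_test_general[OF M])
  have hol: "\<forall>\<^sub>F X in ?F. (\<lambda>u. \<Sum>i\<in>X. f i u) holomorphic_on S"
    by (rule eventually_finite_subsets_at_top_weakI) (auto intro!: holomorphic_on_sum f)
  show "?A holomorphic_on S"
  proof -
    have "?A field_differentiable at v" if v: "v \<in> S" for v
    proof -
      obtain r where r: "r > 0" "cball v r \<subseteq> S"
        using S v by (meson open_contains_cball)
      have "\<forall>\<^sub>F X in ?F. continuous_on (cball v r) (\<lambda>u. \<Sum>i\<in>X. f i u) \<and> (\<lambda>u. \<Sum>i\<in>X. f i u) holomorphic_on ball v r"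
        using hol by eventually_elim
          (meson ball_subset_cball holomorphic_on_imp_continuous_on holomorphic_on_subset order_trans r(2))
      then have "?A holomorphic_on ball v r"
        by (rule holomorphic_uniform_limit[OF _ uniform_limit_on_subset[OF lim r(2)]]) auto
      then show ?thesis
        using r(1) by (auto intro: holomorphic_on_imp_differentiable_at)
    qed
    then show ?thesis
      by (auto simp: holomorphic_on_def field_differentiable_at_within)
  qed
  assume u: "u \<in> S"
  have sum: "(deriv ^^ n) (\<lambda>u. \<Sum>i\<in>X. f i u) v = (\<Sum>i\<in>X. (deriv ^^ n) (f i) v)"
    if "finite X" "X \<subseteq> I" "v \<in> S" for X v
    using that
  proof (induction X rule: finite_induct)
    case (insert i X)
    have "(deriv ^^ n) (\<lambda>u. f i u + (\<Sum>i\<in>X. f i u)) v = (deriv ^^ n) (f i) v + (deriv ^^ n) (\<lambda>u. \<Sum>i\<in>X. f i u) v"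
      using insert.prems by (intro higher_deriv_add[OF _ _ S]) (auto intro!: holomorphic_on_sum f)
    then show ?case
      using insert by simp
  qed simp
  have "((\<lambda>X. (deriv ^^ n) (\<lambda>u. \<Sum>i\<in>X. f i u) u) \<longlongrightarrow> (deriv ^^ n) ?A u) ?F"
    by (rule higher_deriv_complex_uniform_limit[OF lim hol _ S u]) simp
  moreover have "\<forall>\<^sub>F X in ?F. (deriv ^^ n) (\<lambda>u. \<Sum>i\<in>X. f i u) u = (\<Sum>i\<in>X. (deriv ^^ n) (f i) u)"
    by (rule eventually_finite_subsets_at_top_weakI) (use sum u in blast)
  ultimately show "((\<lambda>i. (deriv ^^ n) (f i) u) has_sum (deriv ^^ n) ?A u) I"
    unfolding has_sum_def by (rule Lim_transform_eventually)
qed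

section \<open>Lattice sums and their derivatives\<close>

lemma norm_nome_ratio_le:
  assumes "0 < e" "e \<le> Im z"
  shows "norm (nome_ratio z) \<le> 1 / (exp (2 * pi * e) - 1)"
proof -
  have "exp (2 * pi * e) - 1 \<le> exp (2 * pi * Im z) - 1"
    using assms by simp
  also have "\<dots> \<le> norm (exp (2 * of_real pi * z / \<i>) - 1)"
    using norm_triangle_ineq2[of "exp (2 * of_real pi * z / \<i>)" 1] by (simp only: norm_exp_nome norm_one)
  finally have "exp (2 * pi * e) - 1 \<le> norm (exp (2 * of_real pi * z / \<i>) - 1)" .
  then show ?thesis
    unfolding nome_ratio_def norm_divide norm_one
    using assms by (intro frac_le) auto
qed

text \<open>For c >= 1 the point cz lies at least as high as z, so the nome ratios share one bound
  and 1 / c^j gives convergence.\<close>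

lemma summable_nome_ratio_series:
  fixes K :: "nat set"
  assumes K: "K \<subseteq> {n. n > 0}" and j: "j \<ge> 2" and z: "Im z > 0"
  shows "(\<lambda>c. 1 / of_nat c ^ j * nome_ratio (of_nat c * z)) summable_on K"
proof (rule abs_summable_summable, rule Infinite_Sum.abs_summable_on_comparison_test')
  let ?C = "1 / (exp (2 * pi * Im z) - 1)"
  show "(\<lambda>c. 1 / real c ^ j * ?C) summable_on K"
    using has_sum_imp_summable[OF has_sum_real_zeta(1)[OF j]] K
    by (intro summable_on_cmult_left) (rule summable_on_subset_banach)
  fix c assume "c \<in> K"
  then have "real c \<ge> 1"
    using K by auto
  then have "norm (nome_ratio (of_nat c * z)) \<le> ?C"
    using z by (intro norm_nome_ratio_le) auto
  then show "norm (1 / of_nat c ^ j * nome_ratio (of_nat c * z)) \<le> 1 / real c ^ j * ?C"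
    unfolding norm_mult by (intro mult_mono) (auto simp: norm_divide norm_power)
qed

text \<open>The weight c^(-2m) anticipates the factor c^(2m) produced by m differentiations in u =
  (Im w)^2; with the 1 / c of the row sum it becomes c^(-2m-1).\<close>

lemma has_sum_lattice_row:
  fixes w :: complex and c :: nat
  assumes "c > 0" "Im w > 0"
  shows "((\<lambda>d::int. 1 / real c ^ (2 * m) * (1 / ((of_nat c * Re w + of_int d)\<^sup>2 + (real c)\<^sup>2 * (Im w)\<^sup>2))) has_sum
     (pi / Im w * (1 / real c ^ (2 * m + 1) * (1 + 2 * Re (nome_ratio (of_nat c * w)))))) UNIV"
proof -
  have *: "of_nat c * w = Complex (of_nat c * Re w) (c * Im w)"
    by (simp add: complex_eq_iff)
  have "((\<lambda>d::int. 1 / real c ^ (2 * m) * (1 / ((of_nat c * Re w + of_int d)\<^sup>2 + (real c * Im w)\<^sup>2))) has_sum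
     (1 / real c ^ (2 * m) * (pi / (c * Im w) * (1 + 2 * Re (nome_ratio (of_nat c * w)))))) UNIV"
    unfolding * using assms by (intro has_sum_cmult_right has_sum_int_real) auto
  then show ?thesis
    by (simp add: power_mult_distrib mult_ac)
qed

text \<open>The constant 1 in each row sum collects to \<open>Z\<close>, the nome ratios to the
  Lambert-type series.\<close>

lemma has_sum_lattice_row_sums:
  fixes K :: "nat set"
  assumes K: "K \<subseteq> {n. n > 0}" and m: "m \<ge> 1" and w: "Im w > 0"
    and Z: "((\<lambda>c. 1 / real c ^ (2 * m + 1)) has_sum Z) K"
  shows "((\<lambda>c. pi / Im w * (1 / real c ^ (2 * m + 1) * (1 + 2 * Re (nome_ratio (of_nat c * w))))) has_sum
    (pi / Im w * (Z + 2 * Re (\<Sum>\<^sub>\<infinity>c\<in>K. 1 / of_nat c ^ (2 * m + 1) * nome_ratio (of_nat c * w))))) K"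
proof -
  let ?h = "\<lambda>c::nat. 1 / of_nat c ^ (2 * m + 1) * nome_ratio (of_nat c * w)"
  have "((\<lambda>c. Re (?h c)) has_sum Re (\<Sum>\<^sub>\<infinity>c\<in>K. ?h c)) K"
    using summable_nome_ratio_series[OF K _ w, of "2 * m + 1"] m by (intro has_sum_Re has_sum_infsum) auto
  then have "((\<lambda>c. pi / Im w * (1 / real c ^ (2 * m + 1) + 2 * Re (?h c))) has_sum
      (pi / Im w * (Z + 2 * Re (\<Sum>\<^sub>\<infinity>c\<in>K. ?h c)))) K"
    by (intro has_sum_cmult_right has_sum_add Z)
  moreover have "1 / real c ^ (2 * m + 1) + 2 * Re (?h c) = 1 / real c ^ (2 * m + 1) * (1 + 2 * Re (nome_ratio (of_nat c * w)))" for c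
  proof -
    have "?h c = of_real (1 / real c ^ (2 * m + 1)) * nome_ratio (of_nat c * w)"
      by simp
    then show ?thesis
      by (simp only: times_complex.sel Re_complex_of_real Im_complex_of_real) (simp add: add_divide_distrib)
  qed
  ultimately show ?thesis
    by (simp only:)
qed

text \<open>This links the operator to the lattice sum \<open>L\<close>, for both levels at once:
  \<open>s\<close> is 1 for level 1 and -1 for level 4. The weighted sum A(u) equals pi / y * (Z + 2
  Re H) at u = y^2. Solving for Re H and differentiating m times gives \<open>L\<close> from A and
  the rising factorial from u^(-1/2).\<close>

lemma lattice_sum_dy_inv_y:
  fixes K :: "nat set" and z :: complex and s Z :: real
  assumes K: "K \<subseteq> {n. n > 0}" and m: "m \<ge> 1" and z: "Im z > 0"
    and Z: "((\<lambda>c. 1 / real c ^ (2 * m + 1)) has_sum Z) K"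
    and g: "\<And>w. Im w > 0 \<Longrightarrow>
      g w = s * Re (\<Sum>\<^sub>\<infinity>c\<in>K. 1 / of_nat c ^ (2 * m + 1) * nome_ratio (of_nat c * w))"
  obtains L where
    "((\<lambda>(c, d). 1 / cmod (of_nat c * z + of_int d) ^ (2 * m + 2)) has_sum L) (K \<times> UNIV)"
    "(dy_inv_y ^^ m) g z =
      s * Im z * ((- 2) ^ m * fact m * L / (2 * pi) - Z / 2 * ((- 2) ^ m * pochhammer (1 / 2) m) / Im z ^ (2 * m + 1))"
proof -
  \<comment> \<open>The half-plane Re u > e contains y^2 and stays away from the poles and from the
    cut of u^(-1/2).\<close>
  define x y e where "x = Re z" and "y = Im z" and "e = (Im z)\<^sup>2 / 2"
  have y: "y > 0" and e: "e > 0" "y\<^sup>2 > e"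
    using z by (auto simp: y_def e_def)
  define S where "S = {u. Re u > e}"
  have S: "open S"
    unfolding S_def by (rule open_halfspace_Re_gt)
  define a where "a = (\<lambda>(c::nat, d::int). (real c * x + of_int d)\<^sup>2)"
  define b where "b = (\<lambda>(c::nat, d::int). (real c)\<^sup>2)"
  define k where "k = (\<lambda>(c::nat, d::int). 1 / real c ^ (2 * m))"
  define f where "f = (\<lambda>p u. complex_of_real (k p) * (1 / (of_real (a p) + of_real (b p) * u)))"
  have ab: "a p \<ge> 0" "k p \<ge> 0" for p
    by (auto simp: a_def k_def split: prod.splits)
  have b: "b p > 0" if "p \<in> K \<times> UNIV" for p
    using that K by (auto simp: b_def split: prod.splits)
  have den: "0 < a p + b p * e" "a p + b p * e \<le> norm (of_real (a p) + of_real (b p) * u)"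
    if "p \<in> K \<times> UNIV" "u \<in> S" for p u
  proof -
    show "0 < a p + b p * e"
      using ab(1)[of p] b[OF that(1)] e by (simp add: add_nonneg_pos)
    have "a p + b p * e \<le> a p + b p * Re u"
      using b[OF that(1)] that(2) by (simp add: S_def)
    also have "\<dots> = Re (of_real (a p) + of_real (b p) * u)"
      by simp
    also have "\<dots> \<le> norm (of_real (a p) + of_real (b p) * u)"
      by (rule complex_Re_le_cmod)
    finally show "a p + b p * e \<le> norm (of_real (a p) + of_real (b p) * u)" .
  qed
  have den_nz: "of_real (a p) + of_real (b p) * u \<noteq> 0" if "p \<in> K \<times> UNIV" "u \<in> S" for p u
    using den[OF that] by auto
  \<comment> \<open>The majorant is the term itself at the boundary point u = e, so its summability
    follows from the row evaluations at height \<open>sqrt e\<close>.\<close>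
  define M where "M = (\<lambda>p. k p * (1 / (a p + b p * e)))"
  have f_le: "norm (f p u) \<le> M p" if "p \<in> K \<times> UNIV" "u \<in> S" for p u
    unfolding f_def M_def norm_mult norm_divide norm_one
    using den[OF that] ab(2)[of p] by (intro mult_mono frac_le) auto
  have row: "((\<lambda>d. k (c, d) * (1 / (a (c, d) + b (c, d) * t\<^sup>2))) has_sum
      (pi / t * (1 / real c ^ (2 * m + 1) * (1 + 2 * Re (nome_ratio (of_nat c * Complex x t)))))) UNIV"
    if "c \<in> K" "t > 0" for c t
    using has_sum_lattice_row[of c "Complex x t" m] that K by (auto simp: a_def b_def k_def)
  have M: "M summable_on K \<times> UNIV"
  proof (rule summable_on_SigmaI)
    show "((\<lambda>d. M (c, d)) has_sum
      (pi / sqrt e * (1 / real c ^ (2 * m + 1) * (1 + 2 * Re (nome_ratio (of_nat c * Complex x (sqrt e))))))) UNIV"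
      if "c \<in> K" for c
      using row[OF that, of "sqrt e"] e by (simp add: M_def)
    show "(\<lambda>c. pi / sqrt e * (1 / real c ^ (2 * m + 1) * (1 + 2 * Re (nome_ratio (of_nat c * Complex x (sqrt e)))))) summable_on K"
      using has_sum_lattice_row_sums[OF K m _ Z, of "Complex x (sqrt e)"] e
      by (auto intro: has_sum_imp_summable)
    show "0 \<le> M (c, d)" for c d
      unfolding M_def using ab e by (auto simp: b_def)
  qed
  have f_hol: "f p holomorphic_on S" if "p \<in> K \<times> UNIV" for p
    unfolding f_def using den_nz[OF that] by (intro holomorphic_intros) auto
  define A where "A = (\<lambda>u. \<Sum>\<^sub>\<infinity>p\<in>K \<times> UNIV. f p u)"
  have A_hol: "A holomorphic_on S"
    unfolding A_def by (rule holomorphic_on_infsum(1)[OF S f_hol f_le M])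
  have A_deriv: "((\<lambda>p. (deriv ^^ n) (f p) u) has_sum (deriv ^^ n) A u) (K \<times> UNIV)" if "u \<in> S" for n u
    unfolding A_def by (rule holomorphic_on_infsum(2)[OF S f_hol f_le M that])

  define H where "H = (\<lambda>w. \<Sum>\<^sub>\<infinity>c\<in>K. 1 / of_nat c ^ (2 * m + 1) * nome_ratio (of_nat c * w))"
  have A_eq: "Re (A (of_real (t\<^sup>2))) = pi / t * (Z + 2 * Re (H (Complex x t)))"
    if t: "t > 0" "of_real (t\<^sup>2) \<in> S" for t
  proof -
    have "((\<lambda>p. f p (of_real (t\<^sup>2))) has_sum A (of_real (t\<^sup>2))) (K \<times> UNIV)"
      using A_deriv[OF t(2), of 0] by simp
    then have "((\<lambda>p. Re (f p (of_real (t\<^sup>2)))) has_sum Re (A (of_real (t\<^sup>2)))) (K \<times> UNIV)"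
      by (rule has_sum_Re)
    moreover have "Re (f p (of_real (t\<^sup>2))) = k p * (1 / (a p + b p * t\<^sup>2))" for p
    proof -
      have "f p (of_real (t\<^sup>2)) = of_real (k p * (1 / (a p + b p * t\<^sup>2)))"
        by (simp add: f_def)
      then show ?thesis
        by (simp only: Re_complex_of_real)
    qed
    ultimately have "((\<lambda>p. k p * (1 / (a p + b p * t\<^sup>2))) has_sum Re (A (of_real (t\<^sup>2)))) (K \<times> UNIV)"
      by simp
    then have "((\<lambda>c. pi / t * (1 / real c ^ (2 * m + 1) * (1 + 2 * Re (nome_ratio (of_nat c * Complex x t))))) has_sum
        Re (A (of_real (t\<^sup>2)))) K"
      by (rule has_sum_SigmaD) (use row t(1) in auto)
    moreover have "((\<lambda>c. pi / t * (1 / real c ^ (2 * m + 1) * (1 + 2 * Re (nome_ratio (of_nat c * Complex x t))))) has_sum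
        (pi / t * (Z + 2 * Re (H (Complex x t))))) K"
      using has_sum_lattice_row_sums[OF K m _ Z, of "Complex x t"] t(1) by (simp add: H_def)
    ultimately show ?thesis
      by (rule has_sum_unique)
  qed

  \<comment> \<open>This is \<open>A_eq\<close> solved for s * Re H / y, with 1 / y written as
    u^(-1/2).\<close>
  define B where "B = (\<lambda>u. of_real s * (1 / (2 * of_real pi) * A u - of_real (Z / 2) * u powr (- (1 / 2))))"
  have notneg: "u \<notin> \<real>\<^sub>\<le>\<^sub>0" if "u \<in> S" for u
    using that e by (auto simp: S_def complex_nonpos_Reals_iff)
  have powr_hol: "(\<lambda>u. u powr (- (1 / 2))) holomorphic_on S"
    using notneg by (intro holomorphic_intros) auto
  have B_hol: "B holomorphic_on S"
    unfolding B_def by (intro holomorphic_intros A_hol powr_hol)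
  have powr_eq: "complex_of_real (t\<^sup>2) powr (- (1 / 2) - of_nat n) = of_real (1 / t ^ (2 * n + 1))"
    if "t > 0" for t n
  proof -
    have "complex_of_real (t\<^sup>2) powr (- (1 / 2) - of_nat n) = of_real (t\<^sup>2 powr (- (1 / 2) - of_nat n))"
      using that by (subst powr_of_real[symmetric]) auto
    also have "t\<^sup>2 powr (- (1 / 2) - of_nat n) = t powr (- real (2 * n + 1))"
      using that by (simp add: powr_powr algebra_simps flip: powr_numeral)
    also have "\<dots> = 1 / t ^ (2 * n + 1)"
      using that by (simp only: powr_minus powr_realpow inverse_eq_divide)
    finally show ?thesis .
  qed
  have uS: "of_real (y\<^sup>2) \<in> S"
    using e(2) by (simp add: S_def)
  have T: "(dy_inv_y ^^ m) g (Complex x y) = y * 2 ^ m * Re ((deriv ^^ m) B (of_real (y\<^sup>2)))"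
  proof (rule funpow_dy_inv_y[OF S B_hol _ y uS])
    fix t :: real assume t: "t > 0" "of_real (t\<^sup>2) \<in> S"
    have "B (of_real (t\<^sup>2)) = of_real s * (of_real (1 / (2 * pi)) * A (of_real (t\<^sup>2)) - of_real (Z / 2 * (1 / t)))"
      using powr_eq[OF t(1), of 0] by (simp add: B_def)
    then have "Re (B (of_real (t\<^sup>2))) = s * (1 / (2 * pi) * Re (A (of_real (t\<^sup>2))) - Z / 2 * (1 / t))"
      by (simp only: times_complex.sel minus_complex.sel Re_complex_of_real Im_complex_of_real) simp
    also have "\<dots> = s * Re (H (Complex x t)) / t"
      unfolding A_eq[OF t] using t(1) by (simp add: field_simps)
    finally show "g (Complex x t) = t * Re (B (of_real (t\<^sup>2)))"
      using g[of "Complex x t"] t(1) by (simp add: H_def)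
  qed
  have B_deriv: "(deriv ^^ m) B (of_real (y\<^sup>2)) =
     of_real s * (of_real (1 / (2 * pi)) * (deriv ^^ m) A (of_real (y\<^sup>2))
      - of_real (Z / 2 * ((- 1) ^ m * pochhammer (1 / 2) m * (1 / y ^ (2 * m + 1)))))"
  proof -
    have "(deriv ^^ m) B (of_real (y\<^sup>2)) = of_real s * ((1 / (2 * of_real pi)) * (deriv ^^ m) A (of_real (y\<^sup>2))
       - of_real (Z / 2) * (deriv ^^ m) (\<lambda>u. u powr (- (1 / 2))) (of_real (y\<^sup>2)))"
      unfolding B_def higher_deriv_cmult[OF A_hol uS S, symmetric] higher_deriv_cmult[OF powr_hol uS S, symmetric]
      by (subst higher_deriv_cmult[OF _ uS S], (intro holomorphic_intros A_hol powr_hol),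
          subst higher_deriv_diff[OF _ _ S uS]) (intro holomorphic_intros A_hol powr_hol refl)+
    moreover have "pochhammer (1 / 2) m = complex_of_real (pochhammer (1 / 2) m)"
      using pochhammer_of_real[of "1 / 2 :: real" m, where 'a = complex] by simp
    ultimately show ?thesis
      by (simp only: higher_deriv_powr[OF notneg[OF uS]] powr_eq[OF y]) simp
  qed

  \<comment> \<open>Dividing out the factor common to all termwise derivatives leaves the lattice
    sum, as \<open>f_deriv\<close> shows.\<close>
  define L where "L = Re ((deriv ^^ m) A (of_real (y\<^sup>2))) / ((- 1) ^ m * fact m)"
  have f_deriv: "(deriv ^^ m) (f (c, d)) (of_real (y\<^sup>2)) =
      of_real ((- 1) ^ m * fact m * (1 / cmod (of_nat c * z + of_int d) ^ (2 * m + 2)))"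
    if "c \<in> K" for c d
  proof -
    define q where "q = (real c * x + of_int d)\<^sup>2 + (real c)\<^sup>2 * y\<^sup>2"
    have c: "real c > 0"
      using that K by auto
    have q: "of_real (a (c, d)) + of_real (b (c, d)) * of_real (y\<^sup>2) = complex_of_real q"
      by (simp add: q_def a_def b_def)
    have "q \<noteq> 0"
      using q den_nz[of "(c, d)", OF _ uS] that by auto
    have qn: "q = (cmod (of_nat c * z + of_int d))\<^sup>2"
      unfolding cmod_power2 by (simp add: q_def x_def y_def power_mult_distrib)
    have "(deriv ^^ m) (f (c, d)) (of_real (y\<^sup>2)) = of_real (k (c, d)) *
       (deriv ^^ m) (\<lambda>u. 1 / (of_real (a (c, d)) + of_real (b (c, d)) * u)) (of_real (y\<^sup>2))"
      unfolding f_def using den_nz[of "(c, d)"] that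
      by (intro higher_deriv_cmult[OF _ uS S] holomorphic_intros) auto
    also have "\<dots> = of_real (k (c, d)) * ((- of_real (b (c, d))) ^ m * fact m / of_real q ^ Suc m)"
      using \<open>q \<noteq> 0\<close> by (subst higher_deriv_inverse_affine) (simp_all only: q, simp_all)
    also have "\<dots> = of_real (k (c, d) * ((- b (c, d)) ^ m * fact m / q ^ Suc m))"
      by simp
    \<comment> \<open>The m-th power of c^2 from the chain rule cancels the weight c^(-2m).\<close>
    also have "k (c, d) * ((- b (c, d)) ^ m * fact m / q ^ Suc m) = (- 1) ^ m * fact m * (1 / q ^ Suc m)"
      using c by (simp add: k_def b_def power_minus[of "(real c)\<^sup>2"] power_mult)
    also have "q ^ Suc m = cmod (of_nat c * z + of_int d) ^ (2 * m + 2)"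
      unfolding qn power_mult[symmetric] by simp
    finally show ?thesis .
  qed
  have "((\<lambda>p. Re ((deriv ^^ m) (f p) (of_real (y\<^sup>2)))) has_sum Re ((deriv ^^ m) A (of_real (y\<^sup>2)))) (K \<times> UNIV)"
    by (rule has_sum_Re[OF A_deriv[OF uS]])
  also have "?this \<longleftrightarrow> ((\<lambda>p. ((- 1) ^ m * fact m) * (\<lambda>(c, d). 1 / cmod (of_nat c * z + of_int d) ^ (2 * m + 2)) p)
     has_sum Re ((deriv ^^ m) A (of_real (y\<^sup>2)))) (K \<times> UNIV)"
    by (rule has_sum_cong) (use f_deriv in auto)
  also have "\<dots> \<longleftrightarrow> ((\<lambda>(c, d). 1 / cmod (of_nat c * z + of_int d) ^ (2 * m + 2)) has_sum L) (K \<times> UNIV)"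
    unfolding L_def by (rule has_sum_cmult_right_iff) simp
  finally have L: "((\<lambda>(c, d). 1 / cmod (of_nat c * z + of_int d) ^ (2 * m + 2)) has_sum L) (K \<times> UNIV)" .
  have "Re ((deriv ^^ m) B (of_real (y\<^sup>2))) = s * (1 / (2 * pi) * ((- 1) ^ m * fact m * L)
      - Z / 2 * ((- 1) ^ m * pochhammer (1 / 2) m * (1 / y ^ (2 * m + 1))))"
    unfolding B_deriv L_def
    by (simp only: times_complex.sel minus_complex.sel Re_complex_of_real Im_complex_of_real) simp
  then have "(dy_inv_y ^^ m) g z = y * 2 ^ m * (s * (1 / (2 * pi) * ((- 1) ^ m * fact m * L)
      - Z / 2 * ((- 1) ^ m * pochhammer (1 / 2) m * (1 / y ^ (2 * m + 1)))))"
    using T by (simp add: x_def y_def)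
  also have "\<dots> = s * Im z * ((- 2) ^ m * fact m * L / (2 * pi) - Z / 2 * ((- 2) ^ m * pochhammer (1 / 2) m) / Im z ^ (2 * m + 1))"
    unfolding power_minus[of "2 :: real" m] y_def by (simp add: algebra_simps)
  finally show ?thesis
    by (rule that[OF L])
qed

section \<open>Levels 1 and 4\<close>

lemma suminf_eq_infsum:
  fixes f :: "'b \<Rightarrow> 'a :: banach" and h :: "nat \<Rightarrow> 'b"
  assumes "inj h" and "f summable_on range h"
  shows "(\<Sum>n. f (h n)) = infsum f (range h)"
proof -
  have "((f \<circ> h) has_sum infsum f (range h)) UNIV"
    using has_sum_infsum[OF assms(2)] by (simp only: has_sum_reindex[OF assms(1)])
  then show ?thesis
    using has_sum_imp_sums sums_unique by (fastforce simp: o_def)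
qed

text \<open>The shift by 1 contributes exp (- i pi k), which is -1 for odd k. This reduces the level
  4 series to nome ratios, with a minus sign.\<close>

lemma nome_ratio_half_shift:
  assumes "odd k"
  shows "1 / (exp (of_nat k * of_real pi * (2 * w + 1) / \<i>) + 1) = - nome_ratio (of_nat k * w)"
proof -
  have "of_nat k * of_real pi * (2 * w + 1) / \<i> = 2 * of_real pi * (of_nat k * w) / \<i> + of_nat k * (- (\<i> * of_real pi))"
    by (simp add: field_simps)
  then have "exp (of_nat k * of_real pi * (2 * w + 1) / \<i>) = exp (2 * of_real pi * (of_nat k * w) / \<i>) * exp (- (\<i> * of_real pi)) ^ k"
    by (simp only: exp_add exp_of_nat_mult)
  also have "\<dots> = - exp (2 * of_real pi * (of_nat k * w) / \<i>)"
    using assms by (simp add: exp_minus)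
  finally have *: "exp (of_nat k * of_real pi * (2 * w + 1) / \<i>) + 1 = - (exp (2 * of_real pi * (of_nat k * w) / \<i>) - 1)"
    by simp
  show ?thesis
    unfolding * nome_ratio_def by (simp only: divide_minus_right)
qed

text \<open>The rising factorial is the form in which this value arises from differentiating
  u^(-1/2).\<close>

lemma Gamma_half_nat: "Gamma (of_nat m + 1 / 2 :: complex) = of_real (sqrt pi * pochhammer (1 / 2) m)"
proof -
  have "(1 / 2 :: complex) \<notin> \<int>\<^sub>\<le>\<^sub>0"
    by (auto elim!: nonpos_Ints_cases simp: complex_eq_iff)
  then have "Gamma (1 / 2 + of_nat m :: complex) = Gamma (1 / 2) * pochhammer (1 / 2) m"
    by (subst pochhammer_Gamma) (auto simp: Gamma_eq_zero_iff)
  moreover have "pochhammer (1 / 2) m = complex_of_real (pochhammer (1 / 2) m)"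
    using pochhammer_of_real[of "1 / 2 :: real" m, where 'a = complex] by simp
  ultimately show ?thesis
    by (simp add: Gamma_one_half_complex add.commute)
qed

lemma has_sum_coprime_lattice:
  fixes K :: "nat set"
  assumes K: "K = {n. n > 0 \<and> coprime n l}"
    and L: "((\<lambda>(c, d). 1 / cmod (of_nat c * z + of_int d) ^ j) has_sum L) (K \<times> UNIV)"
    and Z: "((\<lambda>g. 1 / real g ^ j) has_sum Z) K"
  shows "((\<lambda>(c, d). 1 / cmod (of_nat c * z + of_int d) ^ j) has_sum (L / Z)) {(c, d). c \<in> K \<and> coprime (int c) d}"
proof (rule has_sum_coprime_pairs[OF K _ L Z], safe)
  fix g c :: nat and d :: int
  have "of_nat (g * c) * z + of_int (int g * d) = of_nat g * (of_nat c * z + of_int d)"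
    by (simp add: algebra_simps)
  then show "1 / cmod (of_nat (g * c) * z + of_int (int g * d)) ^ j = 1 / cmod (of_nat c * z + of_int d) ^ j / real g ^ j"
    by (simp only: norm_mult norm_of_nat power_mult_distrib) simp
qed

lemma power_quotient_square: "(y / q\<^sup>2) ^ (m + 1) = y ^ (m + 1) * (1 / q ^ (2 * m + 2))" for y q :: real
proof -
  have "(q\<^sup>2) ^ (m + 1) = q ^ (2 * m + 2)"
    unfolding power_mult[symmetric] by simp
  then show ?thesis
    by (simp only: power_divide) simp
qed

text \<open>The representatives are (0, 1) and the coprime rows with c > 0; the latter give the full
  sum \<open>L\<close> divided by zeta(2m+2).\<close>

lemma epstein_zeta_1:
  fixes m :: nat
  assumes z: "Im z > 0"
    and L: "((\<lambda>(c, d). 1 / cmod (of_nat c * z + of_int d) ^ (2 * m + 2)) has_sum L) ({n::nat. n > 0} \<times> UNIV)"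
  shows "epstein_zeta 1 z (of_nat m + 1) =
    of_real (Im z ^ (m + 1) + Im z ^ (m + 1) * (L / Re (zeta (of_nat (2 * m + 2)))))"
proof -
  let ?K = "{n::nat. n > 0}"
  let ?R = "{(c::int, d::int). c > 0 \<and> coprime c d}"
  let ?t = "\<lambda>(c, d). (Im z / (cmod (of_int c * z + of_int d))\<^sup>2) ^ (m + 1)"
  have K: "?K = {n. n > 0 \<and> coprime n 1}"
    by simp
  have "((\<lambda>(c, d). 1 / cmod (of_nat c * z + of_int d) ^ (2 * m + 2)) has_sum (L / Re (zeta (of_nat (2 * m + 2)))))
      {(c, d). c \<in> ?K \<and> coprime (int c) d}"
    by (rule has_sum_coprime_lattice[OF K L has_sum_real_zeta(1)]) simp
  then have "((\<lambda>p. Im z ^ (m + 1) * (\<lambda>(c, d). 1 / cmod (of_nat c * z + of_int d) ^ (2 * m + 2)) p) has_sum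
      (Im z ^ (m + 1) * (L / Re (zeta (of_nat (2 * m + 2)))))) {(c, d). c \<in> ?K \<and> coprime (int c) d}"
    by (rule has_sum_cmult_right)
  also have "?this \<longleftrightarrow> (?t has_sum (Im z ^ (m + 1) * (L / Re (zeta (of_nat (2 * m + 2)))))) ?R"
    by (rule has_sum_reindex_bij_witness[where i = "\<lambda>(c, d). (nat c, d)" and j = "\<lambda>(c, d). (int c, d)"])
       (auto simp: power_quotient_square[simplified])
  finally have R: "(?t has_sum (Im z ^ (m + 1) * (L / Re (zeta (of_nat (2 * m + 2)))))) ?R" .
  \<comment> \<open>The row (0, 1) is the identity coset and contributes the leading term (Im
    z)^(m+1).\<close>
  have "(?t has_sum (\<Sum>p\<in>{(0, 1)}. ?t p)) {(0, 1)}"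
    by (rule has_sum_finite) simp
  then have "(?t has_sum (Im z ^ (m + 1) + Im z ^ (m + 1) * (L / Re (zeta (of_nat (2 * m + 2)))))) ({(0, 1)} \<union> ?R)"
    using R by (intro has_sum_Un_disjoint) auto
  then have "((\<lambda>p. complex_of_real (?t p)) has_sum
      complex_of_real (Im z ^ (m + 1) + Im z ^ (m + 1) * (L / Re (zeta (of_nat (2 * m + 2)))))) ({(0, 1)} \<union> ?R)"
    by (rule has_sum_of_real)
  then have "(\<Sum>\<^sub>\<infinity>p\<in>{(0, 1)} \<union> ?R. complex_of_real (?t p)) =
      of_real (Im z ^ (m + 1) + Im z ^ (m + 1) * (L / Re (zeta (of_nat (2 * m + 2)))))"
    by (rule infsumI)
  moreover have "epstein_zeta 1 z (of_nat (m + 1)) = (\<Sum>\<^sub>\<infinity>(c, d)\<in>{(0, 1)} \<union> ?R.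
      complex_of_real ((Im z / (cmod (of_int c * z + of_int d))\<^sup>2) ^ (m + 1)))"
  proof (rule epstein_zeta_eq_infsum[OF z])
    fix c d :: int assume cd: "coprime c d"
    show "(c, d) \<in> {(0, 1)} \<union> ?R \<longleftrightarrow> (- c, - d) \<notin> {(0, 1)} \<union> ?R"
      using cd by (cases "c = 0") auto
  qed auto
  moreover have "(\<lambda>p. complex_of_real (?t p)) = (\<lambda>(c, d). complex_of_real ((Im z / (cmod (of_int c * z + of_int d))\<^sup>2) ^ (m + 1)))"
    by auto
  ultimately show ?thesis
    by (simp add: add.commute)
qed

text \<open>At -1/(4z) the row (-4d, c) has denominator (cz + d) / z, and its |z| cancels against
  that in the imaginary part. Divisibility by 4 and coprimality force the second entry of a row to
  be odd, so it can be taken positive and becomes the odd coefficient of z.\<close>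

lemma epstein_zeta_4:
  fixes m :: nat
  assumes z: "Im z > 0"
    and L: "((\<lambda>(c, d). 1 / cmod (of_nat c * z + of_int d) ^ (2 * m + 2)) has_sum L) ({n::nat. n > 0 \<and> odd n} \<times> UNIV)"
  shows "epstein_zeta 4 (- (1 / (4 * z))) (of_nat m + 1) =
    of_real ((Im z / 4) ^ (m + 1) * (L / ((1 - 1 / 2 ^ (2 * m + 2)) * Re (zeta (of_nat (2 * m + 2))))))"
proof -
  let ?K = "{n::nat. n > 0 \<and> odd n}" and ?w = "- (1 / (4 * z))"
  let ?R = "{(c::int, d::int). d > 0 \<and> 4 dvd c \<and> coprime c d}"
  let ?t = "\<lambda>(c, d). (Im ?w / (cmod (of_int c * ?w + of_int d))\<^sup>2) ^ (m + 1)"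
  let ?Z = "(1 - 1 / 2 ^ (2 * m + 2)) * Re (zeta (of_nat (2 * m + 2)))"
  have znz: "z \<noteq> 0"
    using z by auto
  have Imw: "Im ?w = Im z / 4 / (cmod z)\<^sup>2"
    by (simp add: complex_div_cnj[of 1] norm_mult power_mult_distrib)
  have w: "Im ?w > 0"
    unfolding Imw using z znz by simp
  have even4: "2 dvd d" if "4 dvd d" for d :: int
    using that by (rule dvd_trans[rotated]) simp
  have K: "?K = {n. n > 0 \<and> coprime n 2}"
    by auto
  have "((\<lambda>(c, d). 1 / cmod (of_nat c * z + of_int d) ^ (2 * m + 2)) has_sum (L / ?Z))
      {(c, d). c \<in> ?K \<and> coprime (int c) d}"
    by (rule has_sum_coprime_lattice[OF K L has_sum_real_zeta_odd]) simp
  then have "((\<lambda>p. (Im z / 4) ^ (m + 1) * (\<lambda>(c, d). 1 / cmod (of_nat c * z + of_int d) ^ (2 * m + 2)) p) has_sum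
      ((Im z / 4) ^ (m + 1) * (L / ?Z))) {(c, d). c \<in> ?K \<and> coprime (int c) d}"
    by (rule has_sum_cmult_right)
  also have "?this \<longleftrightarrow> (?t has_sum ((Im z / 4) ^ (m + 1) * (L / ?Z))) ?R"
  proof (rule has_sum_reindex_bij_witness[where i = "\<lambda>(c, d). (nat d, - (c div 4))" and j = "\<lambda>(c, d). (- 4 * d, int c)"])
    fix p assume "p \<in> {(c, d). c \<in> ?K \<and> coprime (int c) d}"
    then obtain c d where p: "p = (c, d)" "c > 0" "odd c" "coprime (int c) d"
      by auto
    show "(\<lambda>(c, d). (nat d, - (c div 4))) ((\<lambda>(c, d). (- 4 * d, int c)) p) = p"
      by (simp add: p(1))
    have "coprime (4 * d) (int c)"
      using p(3,4) coprime_power_left_iff[of "2::int" 2 "int c"] by (simp add: coprime_commute)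
    then show "(\<lambda>(c, d). (- 4 * d, int c)) p \<in> ?R"
      using p(2) by (simp add: p(1))
    have "of_int (- 4 * d) * ?w + of_int (int c) = (of_nat c * z + of_int d) / z"
      using znz by (simp add: field_simps)
    then have "Im ?w / (cmod (of_int (- 4 * d) * ?w + of_int (int c)))\<^sup>2 = Im z / 4 / (cmod (of_nat c * z + of_int d))\<^sup>2"
      unfolding Imw using znz by (simp only: norm_divide power_divide) simp
    then show "?t ((\<lambda>(c, d). (- 4 * d, int c)) p) =
        (Im z / 4) ^ (m + 1) * (\<lambda>(c, d). 1 / cmod (of_nat c * z + of_int d) ^ (2 * m + 2)) p"
      unfolding p(1) prod.case by (simp only: power_quotient_square)
  next
    fix p assume "p \<in> ?R"
    then obtain c d where p: "p = (4 * c, d)" "d > 0" "coprime (4 * c) d"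
      by auto
    then have "odd d" "coprime c d"
      using coprime_common_divisor[of "4 * c" d 2] even4[of "4 * c"] by auto
    then show "(\<lambda>(c, d). (nat d, - (c div 4))) p \<in> {(c, d). c \<in> ?K \<and> coprime (int c) d}"
      using p(2) by (auto simp: p(1) coprime_commute even_nat_iff)
    show "(\<lambda>(c, d). (- 4 * d, int c)) ((\<lambda>(c, d). (nat d, - (c div 4))) p) = p"
      using p(2) by (simp add: p(1))
  qed simp
  finally have "((\<lambda>p. complex_of_real (?t p)) has_sum complex_of_real ((Im z / 4) ^ (m + 1) * (L / ?Z))) ?R"
    by (rule has_sum_of_real)
  then have "(\<Sum>\<^sub>\<infinity>p\<in>?R. complex_of_real (?t p)) = of_real ((Im z / 4) ^ (m + 1) * (L / ?Z))"
    by (rule infsumI)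
  moreover have "epstein_zeta 4 ?w (of_nat (m + 1)) = (\<Sum>\<^sub>\<infinity>(c, d)\<in>?R.
      complex_of_real ((Im ?w / (cmod (of_int c * ?w + of_int d))\<^sup>2) ^ (m + 1)))"
  proof (rule epstein_zeta_eq_infsum[OF w])
    fix c d :: int assume cd: "coprime c d" "int 4 dvd c"
    then have "d \<noteq> 0"
      by (auto simp: coprime_commute)
    then show "(c, d) \<in> ?R \<longleftrightarrow> (- c, - d) \<notin> ?R"
      using cd by auto
  qed auto
  moreover have "(\<lambda>p. complex_of_real (?t p)) = (\<lambda>(c, d). complex_of_real ((Im ?w / (cmod (of_int c * ?w + of_int d))\<^sup>2) ^ (m + 1)))"
    by auto
  ultimately show ?thesis
    by (simp only: of_nat_add of_nat_1)
qed

section \<open>Assembly of the two formulas\<close>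

theorem theorem1p1:
  fixes z :: complex and m :: nat
  assumes "Im z > 0" and "m \<ge> 1"
  shows "epstein_zeta 1 z (of_nat m + 1) =
           of_real (Im z) ^ (m + 1)
         + of_real (sqrt pi) * Gamma (of_nat m + 1 / 2) / Gamma (of_nat m + 1)
             * (zeta (2 * of_nat m + 1) / zeta (2 * of_nat m + 2)) * (1 / of_real (Im z) ^ m)
         - of_real pi * of_real (Im z) ^ m
             / ((- 2) ^ (m - 1) * Gamma (of_nat m + 1) * zeta (2 * of_nat m + 2))
             * of_real ((dy_inv_y ^^ m)
                 (\<lambda>w. Re (\<Sum>n. 1 / of_nat (Suc n) ^ (2 * m + 1)
                    * (1 / (exp (2 * of_nat (Suc n) * of_real pi * w / \<i>) - 1)))) z)
       \<and> epstein_zeta 4 (- (1 / (4 * z))) (of_nat m + 1) =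
           (2 ^ (2 * m + 1) - 1) / (2 ^ (2 * m + 2) - 1)
             * (of_real (sqrt pi) * Gamma (of_nat m + 1 / 2) / (2 * Gamma (of_nat m + 1)))
             * (zeta (2 * of_nat m + 1) / zeta (2 * of_nat m + 2)) * (1 / of_real (4 * Im z) ^ m)
         + of_real pi * of_real (Im z) ^ m
             / ((- 2) ^ (m - 1) * (2 ^ (2 * m + 2) - 1) * Gamma (of_nat m + 1)
                  * zeta (2 * of_nat m + 2))
             * of_real ((dy_inv_y ^^ m)
                 (\<lambda>w. Re (\<Sum>n. 1 / of_nat (2 * n + 1) ^ (2 * m + 1)
                    * (1 / (exp (of_nat (2 * n + 1) * of_real pi * (2 * w + 1) / \<i>) + 1)))) z)"
proof
  let ?y = "Im z"
  define Z1 Z2 p q where "Z1 = Re (zeta (of_nat (2 * m + 1)))" and "Z2 = Re (zeta (of_nat (2 * m + 2)))"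
    and "p = pochhammer (1 / 2 :: real) m" and "q = (- 2 :: real) ^ (m - 1)"
  have y: "?y > 0"
    by (rule assms)
  have zetas: "zeta (2 * of_nat m + 1) = of_real Z1" "zeta (2 * of_nat m + 2) = of_real Z2"
    using has_sum_real_zeta(2)[of "2 * m + 1"] has_sum_real_zeta(2)[of "2 * m + 2"] assms(2)
    by (simp_all add: Z1_def Z2_def add.commute)
  have Z2: "Z2 > 0"
  proof -
    have "(\<Sum>n\<in>{1::nat}. 1 / real n ^ (2 * m + 2)) \<le> Z2"
      unfolding Z2_def by (rule finite_sum_le_has_sum[OF has_sum_real_zeta(1)]) auto
    then show ?thesis
      by simp
  qed
  have Gammas: "Gamma (of_nat m + 1 / 2) = complex_of_real (sqrt pi * p)" "Gamma (of_nat m + 1) = complex_of_real (fact m)"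
    using Gamma_half_nat[of m] Gamma_fact[of m, where 'a = complex] by (simp_all add: p_def add.commute)
  have ypow: "?y ^ (2 * m + 1) = ?y * (?y ^ m * ?y ^ m)" "?y ^ (m + 1) = ?y * ?y ^ m"
    by (simp_all add: mult_2 power_add)
  \<comment> \<open>Since m >= 1, the subtraction m - 1 is not truncated.\<close>
  have q: "q \<noteq> 0" "(- 2 :: real) ^ m = - 2 * q"
    using assms(2) by (cases m; simp add: q_def)+
  have qc: "(- 2 :: complex) ^ (m - 1) = of_real q"
    by (simp add: q_def)

  define g1 where "g1 = (\<lambda>w. Re (\<Sum>n. 1 / of_nat (Suc n) ^ (2 * m + 1)
                    * (1 / (exp (2 * of_nat (Suc n) * of_real pi * w / \<i>) - 1))))"
  have g1: "g1 w = 1 * Re (\<Sum>\<^sub>\<infinity>c\<in>{n::nat. n > 0}. 1 / of_nat c ^ (2 * m + 1) * nome_ratio (of_nat c * w))"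
    if "Im w > 0" for w
  proof -
    let ?h = "\<lambda>c::nat. 1 / of_nat c ^ (2 * m + 1) * nome_ratio (of_nat c * w)"
    have pos: "{n::nat. n > 0} = range Suc"
      using greaterThan_0 by auto
    have "?h summable_on range Suc"
      using assms(2) that by (intro summable_nome_ratio_series) auto
    then have "infsum ?h {n. n > 0} = (\<Sum>n. ?h (Suc n))"
      unfolding pos by (rule suminf_eq_infsum[OF inj_Suc, symmetric])
    then show ?thesis
      by (simp only: g1_def nome_ratio_def mult_1 mult.assoc mult.left_commute[of "of_real pi"])
  qed
  obtain L1 where L1: "((\<lambda>(c, d). 1 / cmod (of_nat c * z + of_int d) ^ (2 * m + 2)) has_sum L1) ({n::nat. n > 0} \<times> UNIV)"
    and T1: "(dy_inv_y ^^ m) g1 z =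
      1 * ?y * ((- 2) ^ m * fact m * L1 / (2 * pi) - Z1 / 2 * ((- 2) ^ m * p) / ?y ^ (2 * m + 1))"
    using lattice_sum_dy_inv_y[OF order_refl assms(2,1) has_sum_real_zeta(1) g1] assms(2)
    unfolding Z1_def p_def by auto
  \<comment> \<open>This is \<open>T1\<close> solved for \<open>L1\<close>. The explicit sqrt pi and
    the one inside Gamma(m + 1/2) combine to pi.\<close>
  have R1: "?y ^ (m + 1) + ?y ^ (m + 1) * (L1 / Z2) =
      ?y ^ (m + 1) + sqrt pi * (sqrt pi * p) / fact m * (Z1 / Z2) * (1 / ?y ^ m)
      - pi * ?y ^ m / (q * fact m * Z2) * (dy_inv_y ^^ m) g1 z"
    unfolding T1 q(2) ypow using y q(1) Z2 by (simp add: field_simps)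
  show "epstein_zeta 1 z (of_nat m + 1) =
           of_real (Im z) ^ (m + 1)
         + of_real (sqrt pi) * Gamma (of_nat m + 1 / 2) / Gamma (of_nat m + 1)
             * (zeta (2 * of_nat m + 1) / zeta (2 * of_nat m + 2)) * (1 / of_real (Im z) ^ m)
         - of_real pi * of_real (Im z) ^ m
             / ((- 2) ^ (m - 1) * Gamma (of_nat m + 1) * zeta (2 * of_nat m + 2))
             * of_real ((dy_inv_y ^^ m)
                 (\<lambda>w. Re (\<Sum>n. 1 / of_nat (Suc n) ^ (2 * m + 1)
                    * (1 / (exp (2 * of_nat (Suc n) * of_real pi * w / \<i>) - 1)))) z)"
    unfolding epstein_zeta_1[OF y L1] Z2_def[symmetric] zetas Gammas qc g1_def[symmetric] R1
    by (simp only: of_real_add of_real_diff of_real_mult of_real_divide of_real_power of_real_1)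

  define g2 where "g2 = (\<lambda>w. Re (\<Sum>n. 1 / of_nat (2 * n + 1) ^ (2 * m + 1)
                    * (1 / (exp (of_nat (2 * n + 1) * of_real pi * (2 * w + 1) / \<i>) + 1))))"
  have g2: "g2 w = - 1 * Re (\<Sum>\<^sub>\<infinity>c\<in>{n::nat. n > 0 \<and> odd n}. 1 / of_nat c ^ (2 * m + 1) * nome_ratio (of_nat c * w))"
    if "Im w > 0" for w
  proof -
    let ?h = "\<lambda>c::nat. 1 / of_nat c ^ (2 * m + 1) * nome_ratio (of_nat c * w)"
    have odds: "{n::nat. n > 0 \<and> odd n} = range (\<lambda>n. 2 * n + 1)"
      by (auto elim!: oddE)
    have inj: "inj (\<lambda>n::nat. 2 * n + 1)"
      by (auto intro: injI)
    have on: "?h summable_on range (\<lambda>n. 2 * n + 1)"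
      using assms(2) that by (intro summable_nome_ratio_series) auto
    have sums: "(\<Sum>n. ?h (2 * n + 1)) = infsum ?h (range (\<lambda>n. 2 * n + 1))"
      by (rule suminf_eq_infsum[OF inj on])
    have "summable (\<lambda>n. ?h (2 * n + 1))"
      by (rule summable_on_imp_summable) (use on in \<open>simp only: summable_on_reindex[OF inj] o_def\<close>)
    have "g2 w = Re (\<Sum>n. - ?h (2 * n + 1))"
      unfolding g2_def
      by (subst nome_ratio_half_shift) (simp_all only: mult_minus_right, simp)
    also have "\<dots> = - 1 * Re (infsum ?h (range (\<lambda>n. 2 * n + 1)))"
      unfolding sums[symmetric] using \<open>summable (\<lambda>n. ?h (2 * n + 1))\<close> by (subst suminf_minus) auto
    finally show ?thesis
      unfolding odds .
  qed
  \<comment> \<open>All powers of 2 are expressed by r: 2^(2m+2) = 2r, 4^m = r/2 and 4^(m+1) = 2r.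
    The level 4 identity thereby becomes rational in r.\<close>
  define r where "r = (2 :: real) ^ (2 * m + 1)"
  have r: "r > 1"
    unfolding r_def by (rule one_less_power) auto
  obtain L2 where L2: "((\<lambda>(c, d). 1 / cmod (of_nat c * z + of_int d) ^ (2 * m + 2)) has_sum L2) ({n::nat. n > 0 \<and> odd n} \<times> UNIV)"
    and T2: "(dy_inv_y ^^ m) g2 z =
      - 1 * ?y * ((- 2) ^ m * fact m * L2 / (2 * pi) - (1 - 1 / r) * Z1 / 2 * ((- 2) ^ m * p) / ?y ^ (2 * m + 1))"
    using lattice_sum_dy_inv_y[OF _ assms(2,1) has_sum_real_zeta_odd g2] assms(2)
    unfolding Z1_def p_def r_def by auto
  have pow: "(2 :: real) ^ (2 * m + 2) = 2 * r" "(4 :: real) ^ m = r / 2" "(4 :: real) ^ (m + 1) = 2 * r"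
    by (simp_all add: r_def power_mult)
  have powc: "(2 :: complex) ^ (2 * m + 2) = of_real (2 * r)" "(2 :: complex) ^ (2 * m + 1) = of_real r"
    by (simp_all add: r_def)
  have R2: "(?y / 4) ^ (m + 1) * (L2 / ((1 - 1 / (2 * r)) * Z2)) =
      (r - 1) / (2 * r - 1) * (sqrt pi * (sqrt pi * p) / (2 * fact m)) * (Z1 / Z2) * (1 / (4 * ?y) ^ m)
      + pi * ?y ^ m / (q * (2 * r - 1) * fact m * Z2) * (dy_inv_y ^^ m) g2 z"
  proof -
    \<comment> \<open>Up to the factor 2r, this is the Euler factor at 2 removed from zeta(2m+2); it
      is positive and may be cancelled.\<close>
    define t where "t = 2 * r - 1"
    have t: "t > 0" "1 - 1 / (2 * r) = t / (2 * r)"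
      using r by (simp_all add: t_def field_simps)
    show ?thesis
      unfolding T2 q(2) ypow t_def[symmetric] t(2) power_divide power_mult_distrib pow
      using y q(1) Z2 r t(1) by (simp add: field_simps)
  qed
  show "epstein_zeta 4 (- (1 / (4 * z))) (of_nat m + 1) =
           (2 ^ (2 * m + 1) - 1) / (2 ^ (2 * m + 2) - 1)
             * (of_real (sqrt pi) * Gamma (of_nat m + 1 / 2) / (2 * Gamma (of_nat m + 1)))
             * (zeta (2 * of_nat m + 1) / zeta (2 * of_nat m + 2)) * (1 / of_real (4 * Im z) ^ m)
         + of_real pi * of_real (Im z) ^ m
             / ((- 2) ^ (m - 1) * (2 ^ (2 * m + 2) - 1) * Gamma (of_nat m + 1)
                  * zeta (2 * of_nat m + 2))
             * of_real ((dy_inv_y ^^ m)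
                 (\<lambda>w. Re (\<Sum>n. 1 / of_nat (2 * n + 1) ^ (2 * m + 1)
                    * (1 / (exp (of_nat (2 * n + 1) * of_real pi * (2 * w + 1) / \<i>) + 1)))) z)"
    unfolding epstein_zeta_4[OF y L2] Z2_def[symmetric] zetas Gammas qc g2_def[symmetric] powc pow(1) R2
    by (simp only: of_real_add of_real_diff of_real_mult of_real_divide of_real_power of_real_1 of_real_numeral)
qed

end
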